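(* There exists a smooth embedding $F_0:M\to\mathbb{R}^4$ of a two-torus $M$ whose normal bundle is flat, such that along the mean curvature flow $F:M\times[0,T)\to\mathbb{R}^4$ starting from $F_0$ there is $\delta\in(0,T)$ with the property that for every $t\in(0,\delta)$ the normal bundle of $F_t=F(\cdot,t)$ is not flat.
   Context: For an immersion $F:M^m\to\mathbb{R}^n$, the normal connection is $\nabla^\perp_X\nu=(D_X\nu)^\perp$, where $D$ is the Euclidean connection and $(\cdot)^\perp$ is the projection to the normal bundle $T^\perp M$. Its curvature is $R^\perp(X,Y)\nu=\nabla^\perp_X\nabla^\perp_Y\nu-\nabla^\perp_Y\nabla^\perp_X\nu-\nabla^\perp_{[X,Y]}\nu$. The immersion has flat normal bundle if $R^\perp\equiv0$. The second fundamental form is $A(X,Y)=(D_XY)^\perp$ and the mean curvature vector is $H=\mathrm{tr}_g A$, where $g$ is the induced metric. A mean curvature flow starting from $F_0$ is a smooth family of immersions $F:M\times[0,T)\to\mathbb{R}^n$, $T>0$, with $\frac{dF}{dt}(\cdot,t)=H(\cdot,t)$ and $F(\cdot,0)=F_0$; here $H(\cdot,t)$ is the mean curvature vector of $F(\cdot,t)$. For compact $M$ without boundary, a unique such smooth solution exists on a short time interval. *)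

theory Defs
  imports "HOL-Analysis.Analysis"
begin

text \<open>
  \<open>Ck_on k U f\<close> and \<open>Cinf_on U f\<close> are meant for open \<open>U\<close>. Smoothness on an arbitrary set (needed for
  \<open>M \<times> [0,T)\<close>, which has boundary at \<open>t = 0\<close>) means having smooth local extensions.
\<close>

fun Ck_on :: "nat \<Rightarrow> 'a::euclidean_space set \<Rightarrow> ('a \<Rightarrow> 'b::euclidean_space) \<Rightarrow> bool" where
  "Ck_on 0 U f \<longleftrightarrow> continuous_on U f"
| "Ck_on (Suc k) U f \<longleftrightarrow>
     (\<forall>x\<in>U. f differentiable (at x)) \<and> (\<forall>v. Ck_on k U (\<lambda>x. frechet_derivative f (at x) v))"

definition Cinf_on :: "'a::euclidean_space set \<Rightarrow> ('a \<Rightarrow> 'b::euclidean_space) \<Rightarrow> bool" where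
  "Cinf_on U f \<longleftrightarrow> (\<forall>k. Ck_on k U f)"

definition smooth_on :: "'a::euclidean_space set \<Rightarrow> ('a \<Rightarrow> 'b::euclidean_space) \<Rightarrow> bool" where
  "smooth_on S f \<longleftrightarrow>
     (\<forall>x\<in>S. \<exists>U G. open U \<and> x \<in> U \<and> Cinf_on U G \<and> (\<forall>y\<in>S \<inter> U. G y = f y))"

text \<open>
  The torus is \<open>\<real>\<^sup>m / \<int>\<^sup>m\<close>. Maps from it, its vector fields (in the global coordinate frame) and
  sections over it are represented by their \<open>\<int>\<^sup>m\<close>-periodic lifts to \<open>\<real>\<^sup>m\<close>.
  The map \<open>torus_proj\<close> identifies the quotient with the product of circles \<open>torus\<close> in \<open>\<complex>\<^sup>m\<close>.
\<close>

definition periodic :: "(real^'m \<Rightarrow> 'b) \<Rightarrow> bool" where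
  "periodic f \<longleftrightarrow> (\<forall>x k. (\<forall>i. k $ i \<in> \<int>) \<longrightarrow> f (x + k) = f x)"

definition torus :: "(complex^'m) set" where
  "torus = {z. \<forall>i. norm (z $ i) = 1}"

definition torus_proj :: "real^'m \<Rightarrow> complex^'m" where
  "torus_proj x = (\<chi> i. cis (2 * pi * x $ i))"

definition torus_smooth :: "(real^'m \<Rightarrow> 'b::euclidean_space) \<Rightarrow> bool" where
  "torus_smooth f \<longleftrightarrow> periodic f \<and> Cinf_on UNIV f"

definition torus_immersion :: "(real^'m \<Rightarrow> real^'n) \<Rightarrow> bool" where
  "torus_immersion F \<longleftrightarrow> torus_smooth F \<and> (\<forall>x. inj (frechet_derivative F (at x)))"

definition torus_embedding :: "(real^'m \<Rightarrow> real^'n) \<Rightarrow> bool" where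
  "torus_embedding F \<longleftrightarrow> torus_immersion F \<and>
     (\<exists>f. F = f \<circ> torus_proj \<and> embedding_map (top_of_set torus) euclidean f)"

definition tangent_space :: "(real^'m \<Rightarrow> real^'n) \<Rightarrow> real^'m \<Rightarrow> (real^'n) set" where
  "tangent_space F x = range (frechet_derivative F (at x))"

definition normal_space :: "(real^'m \<Rightarrow> real^'n) \<Rightarrow> real^'m \<Rightarrow> (real^'n) set" where
  "normal_space F x = orthogonal_comp (tangent_space F x)"

definition normal_part :: "(real^'m \<Rightarrow> real^'n) \<Rightarrow> real^'m \<Rightarrow> real^'n \<Rightarrow> real^'n" where
  "normal_part F x w = (THE \<nu>. \<nu> \<in> normal_space F x \<and> w - \<nu> \<in> tangent_space F x)"

definition dir_deriv :: "(real^'m \<Rightarrow> real^'m) \<Rightarrow> (real^'m \<Rightarrow> real^'k) \<Rightarrow> real^'m \<Rightarrow> real^'k" where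
  "dir_deriv X V x = frechet_derivative V (at x) (X x)"

definition lie_bracket :: "(real^'m \<Rightarrow> real^'m) \<Rightarrow> (real^'m \<Rightarrow> real^'m) \<Rightarrow> real^'m \<Rightarrow> real^'m" where
  "lie_bracket X Y x = dir_deriv X Y x - dir_deriv Y X x"

definition normal_connection ::
  "(real^'m \<Rightarrow> real^'n) \<Rightarrow> (real^'m \<Rightarrow> real^'m) \<Rightarrow> (real^'m \<Rightarrow> real^'n) \<Rightarrow> real^'m \<Rightarrow> real^'n" where
  "normal_connection F X \<nu> x = normal_part F x (dir_deriv X \<nu> x)"

definition normal_curvature ::
  "(real^'m \<Rightarrow> real^'n) \<Rightarrow> (real^'m \<Rightarrow> real^'m) \<Rightarrow> (real^'m \<Rightarrow> real^'m) \<Rightarrow>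
   (real^'m \<Rightarrow> real^'n) \<Rightarrow> real^'m \<Rightarrow> real^'n" where
  "normal_curvature F X Y \<nu> x =
     normal_connection F X (normal_connection F Y \<nu>) x
   - normal_connection F Y (normal_connection F X \<nu>) x
   - normal_connection F (lie_bracket X Y) \<nu> x"

definition flat_normal_bundle :: "(real^'m \<Rightarrow> real^'n) \<Rightarrow> bool" where
  "flat_normal_bundle F \<longleftrightarrow>
     (\<forall>X Y \<nu>. torus_smooth X \<longrightarrow> torus_smooth Y \<longrightarrow>
        torus_smooth \<nu> \<longrightarrow> (\<forall>x. \<nu> x \<in> normal_space F x) \<longrightarrow>
        (\<forall>x. normal_curvature F X Y \<nu> x = 0))"

definition second_fundamental_form ::
  "(real^'m \<Rightarrow> real^'n) \<Rightarrow> (real^'m \<Rightarrow> real^'m) \<Rightarrow> (real^'m \<Rightarrow> real^'m) \<Rightarrow> real^'m \<Rightarrow> real^'n" where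
  "second_fundamental_form F X Y x = normal_part F x (dir_deriv X (dir_deriv Y F) x)"

definition induced_metric :: "(real^'m \<Rightarrow> real^'n) \<Rightarrow> real^'m \<Rightarrow> real^'m^'m" where
  "induced_metric F x =
     (\<chi> i j. frechet_derivative F (at x) (axis i 1) \<bullet> frechet_derivative F (at x) (axis j 1))"

definition mean_curvature :: "(real^'m \<Rightarrow> real^'n) \<Rightarrow> real^'m \<Rightarrow> real^'n" where
  "mean_curvature F x =
     (\<Sum>i\<in>UNIV. \<Sum>j\<in>UNIV. matrix_inv (induced_metric F x) $ i $ j *\<^sub>R
        second_fundamental_form F (\<lambda>_. axis i 1) (\<lambda>_. axis j 1) x)"

definition mean_curvature_flow ::
  "(real^'m \<Rightarrow> real^'n) \<Rightarrow> real \<Rightarrow> (real \<Rightarrow> real^'m \<Rightarrow> real^'n) \<Rightarrow> bool" where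
  "mean_curvature_flow F0 T F \<longleftrightarrow>
     T > 0 \<and>
     smooth_on (UNIV \<times> {0..<T}) (\<lambda>(x, t). F t x) \<and>
     (\<forall>t\<in>{0..<T}. torus_immersion (F t)) \<and>
     (\<forall>t\<in>{0..<T}. \<forall>x.
        ((\<lambda>s. F s x) has_vector_derivative mean_curvature (F t) x) (at t within {0..<T})) \<and>
     F 0 = F0"

end

theory Submission
  imports Defs
begin

text \<open>
  The initial surface is, in angles \<open>\<theta>\<close> and \<open>\<phi>\<close>, a family over the circle \<open>(cos \<phi>, sin \<phi>)\<close> of parallel
  curves at distance \<open>sin \<phi>\<close> of a fixed non-circular convex plane curve. Its coordinate fields are
  orthogonal and \<open>\<partial>\<^sub>\<theta>\<partial>\<^sub>\<phi>F\<close> is tangent, so all shape operators are diagonal in these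
  coordinates and, by the Ricci equation, the normal bundle is flat.

  For any immersion, flatness at a point forces the vanishing of \<open>K\<close>, a polynomial in
  the first and second derivatives of the immersion. Along the flow \<open>K\<close> vanishes at \<open>t = 0\<close>. Its time
  derivative there is obtained by replacing \<open>\<partial>\<^sub>t\<close> of the derivatives of \<open>F\<close> by derivatives of the mean
  curvature vector. With \<open>\<rho>\<close> the radius of curvature of the plane curves, it is a multiple
  of \<open>\<partial>\<^sub>\<theta>\<rho>\<close>, which is nonzero at the origin. Hence \<open>K \<noteq> 0\<close> for small \<open>t > 0\<close>.
\<close>

section \<open>Directional derivatives and smoothness\<close>

text \<open>The direction comes first, so that \<open>dirD v f\<close> is again a map and
  derivatives can be iterated.\<close>

definition dirD :: "'a::real_normed_vector \<Rightarrow> ('a \<Rightarrow> 'b::real_normed_vector) \<Rightarrow> 'a \<Rightarrow> 'b" where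
  "dirD v f x = frechet_derivative f (at x) v"

lemma dirD_eqI: "(f has_derivative f') (at x) \<Longrightarrow> dirD v f x = f' v"
  unfolding dirD_def using frechet_derivative_at by metis

lemma has_derivative_dirD:
  "f differentiable (at x) \<Longrightarrow> (f has_derivative (\<lambda>v. dirD v f x)) (at x)"
  unfolding dirD_def using frechet_derivative_works by metis

lemma dirD_add_left:
  "f differentiable (at x) \<Longrightarrow> dirD (u + v) f x = dirD u f x + dirD v f x"
  unfolding dirD_def using linear_frechet_derivative linear_add by blast

lemma dirD_scaleR_left:
  "f differentiable (at x) \<Longrightarrow> dirD (c *\<^sub>R v) f x = c *\<^sub>R dirD v f x"
  unfolding dirD_def using linear_frechet_derivative linear_scale by blast

lemma dirD_cong:
  assumes "open U" "x \<in> U" "f differentiable (at x)" "\<And>y. y \<in> U \<Longrightarrow> f y = g y"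
  shows "dirD v g x = dirD v f x"
  unfolding dirD_def using frechet_derivative_transform_within_open[of f x U g] assms by simp

lemma dirD_add:
  assumes "f differentiable (at x)" "g differentiable (at x)"
  shows "dirD v (\<lambda>x. f x + g x) x = dirD v f x + dirD v g x"
  by (rule dirD_eqI) (intro has_derivative_add has_derivative_dirD assms)

lemma (in bounded_bilinear) dirD_prod:
  assumes "f differentiable (at x)" "g differentiable (at x)"
  shows "dirD v (\<lambda>x. prod (f x) (g x)) x = prod (f x) (dirD v g x) + prod (dirD v f x) (g x)"
  by (rule dirD_eqI) (intro FDERIV has_derivative_dirD assms)

lemmas dirD_inner = bounded_bilinear.dirD_prod[OF bounded_bilinear_inner]
lemmas dirD_scaleR = bounded_bilinear.dirD_prod[OF bounded_bilinear_scaleR]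

lemma dirD_line:
  assumes "f differentiable (at (x + s *\<^sub>R v))"
  shows "((\<lambda>s. f (x + s *\<^sub>R v)) has_vector_derivative dirD v f (x + s *\<^sub>R v)) (at s within S)"
proof -
  have "((\<lambda>s. x + s *\<^sub>R v) has_derivative (\<lambda>h. h *\<^sub>R v)) (at s within S)"
    by (auto intro!: derivative_eq_intros)
  from has_derivative_compose[OF this has_derivative_dirD[OF assms]] show ?thesis
    unfolding has_vector_derivative_def by (simp add: dirD_scaleR_left[OF assms])
qed

section \<open>Calculus of C^k and smooth maps on open sets\<close>

lemma Ck_on_Suc:
  "Ck_on (Suc k) U f \<longleftrightarrow> (\<forall>x\<in>U. f differentiable (at x)) \<and> (\<forall>v. Ck_on k U (dirD v f))"
  by (simp add: dirD_def[abs_def])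

declare Ck_on.simps(2) [simp del]

text \<open>The sum and product rules compute derivatives only at points of \<open>U\<close>. Since
  \<open>U\<close> is open, values on \<open>U\<close> determine the derivatives there, so these
  formulas may replace the derivatives inside \<open>Ck_on\<close>.\<close>

lemma Ck_on_cong:
  assumes "open U" "\<And>x. x \<in> U \<Longrightarrow> f x = g x" "Ck_on k U f"
  shows "Ck_on k U g"
  using assms(2,3)
proof (induction k arbitrary: f g)
  case 0
  then show ?case using continuous_on_cong by fastforce
next
  case (Suc k)
  have df: "f differentiable (at x)" if "x \<in> U" for x
    using Suc.prems that by (simp add: Ck_on_Suc)
  have "g differentiable (at x)" if "x \<in> U" for x
    using has_derivative_transform_within_open[OF has_derivative_dirD[OF df[OF that]] assms(1) that]
      Suc.prems(1) unfolding differentiable_def by blast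
  moreover have "Ck_on k U (dirD v g)" for v
  proof (rule Suc.IH)
    show "dirD v f x = dirD v g x" if "x \<in> U" for x
      using dirD_cong[OF assms(1) that df[OF that], of g] Suc.prems(1) by simp
    show "Ck_on k U (dirD v f)" using Suc.prems(2) by (simp add: Ck_on_Suc)
  qed
  ultimately show ?case by (simp add: Ck_on_Suc)
qed

lemma Ck_on_SucD: "Ck_on (Suc k) U f \<Longrightarrow> Ck_on k U f"
proof (induction k arbitrary: f)
  case 0
  then show ?case
    by (auto simp: Ck_on_Suc intro!: continuous_at_imp_continuous_on differentiable_imp_continuous_within)
next
  case (Suc k)
  then show ?case by (subst Ck_on_Suc) (auto simp: Ck_on_Suc[of "Suc k"])
qed

lemma Ck_on_const: "Ck_on k U (\<lambda>x::'a::euclidean_space. c)"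
proof (induction k arbitrary: c)
  case (Suc k)
  have "dirD v (\<lambda>x::'a. c) = (\<lambda>x. 0)" for v by (simp add: dirD_def[abs_def])
  with Suc show ?case by (simp add: Ck_on_Suc)
qed simp

lemma Ck_on_add:
  assumes "open U" "Ck_on k U f" "Ck_on k U g"
  shows "Ck_on k U (\<lambda>x. f x + g x)"
  using assms(2,3)
proof (induction k arbitrary: f g)
  case 0
  then show ?case by (simp add: continuous_on_add)
next
  case (Suc k)
  then have d: "f differentiable (at x)" "g differentiable (at x)" if "x \<in> U" for x
    using that by (simp_all add: Ck_on_Suc)
  have "Ck_on k U (dirD v (\<lambda>x. f x + g x))" for v
    by (rule Ck_on_cong[OF assms(1) dirD_add[symmetric] Suc.IH]) (use d Suc.prems in \<open>auto simp: Ck_on_Suc\<close>)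
  then show ?case using d by (simp add: Ck_on_Suc)
qed

text \<open>An arbitrary bounded bilinear map covers scalar multiples, products and inner products
  at once. Each term of the product rule keeps one factor undifferentiated;
  \<open>Ck_on_SucD\<close> lowers its order to meet the induction hypothesis.\<close>

lemma Ck_on_prod:
  fixes f :: "'a::euclidean_space \<Rightarrow> 'b::euclidean_space" and g :: "'a \<Rightarrow> 'c::euclidean_space"
    and prod :: "'b \<Rightarrow> 'c \<Rightarrow> 'd::euclidean_space"
  assumes bil: "bounded_bilinear prod" and "open U" "Ck_on k U f" "Ck_on k U g"
  shows "Ck_on k U (\<lambda>x. prod (f x) (g x))"
  using assms(3,4)
proof (induction k arbitrary: f g)
  case 0
  then show ?case by (simp add: bounded_bilinear.continuous_on[OF bil])
next
  case (Suc k)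
  then have d: "f differentiable (at x)" "g differentiable (at x)" if "x \<in> U" for x
    using that by (simp_all add: Ck_on_Suc)
  have "Ck_on k U (dirD v (\<lambda>x. prod (f x) (g x)))" for v
    by (rule Ck_on_cong[OF assms(2) bounded_bilinear.dirD_prod[OF bil, symmetric]
          Ck_on_add[OF assms(2) Suc.IH Suc.IH]])
      (use d Suc.prems Ck_on_SucD[OF Suc.prems(1)] Ck_on_SucD[OF Suc.prems(2)] in \<open>auto simp: Ck_on_Suc\<close>)
  moreover have "(\<lambda>x. prod (f x) (g x)) differentiable (at x)" if "x \<in> U" for x
    using bounded_bilinear.FDERIV[OF bil has_derivative_dirD has_derivative_dirD] d[OF that]
    unfolding differentiable_def by blast
  ultimately show ?case by (simp add: Ck_on_Suc)
qed

lemma Cinf_on_differentiable: "Cinf_on U f \<Longrightarrow> x \<in> U \<Longrightarrow> f differentiable (at x)"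
  unfolding Cinf_on_def using Ck_on_Suc by blast

lemma Cinf_on_dirD: "Cinf_on U f \<Longrightarrow> Cinf_on U (dirD v f)"
  unfolding Cinf_on_def using Ck_on_Suc by blast

lemma Cinf_on_continuous_on: "Cinf_on U f \<Longrightarrow> continuous_on U f"
  unfolding Cinf_on_def using Ck_on.simps(1) by blast

lemma Cinf_on_const: "Cinf_on U (\<lambda>x. c)"
  by (simp add: Cinf_on_def Ck_on_const)

lemma Cinf_on_add: "open U \<Longrightarrow> Cinf_on U f \<Longrightarrow> Cinf_on U g \<Longrightarrow> Cinf_on U (\<lambda>x. f x + g x)"
  by (simp add: Cinf_on_def Ck_on_add)

lemma Cinf_on_scaleR:
  "open U \<Longrightarrow> Cinf_on U f \<Longrightarrow> Cinf_on U g \<Longrightarrow> Cinf_on U (\<lambda>x. f x *\<^sub>R g x)"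
  by (simp add: Cinf_on_def Ck_on_prod[OF bounded_bilinear_scaleR])

lemma Cinf_on_mult:
  fixes f g :: "'a::euclidean_space \<Rightarrow> real"
  shows "open U \<Longrightarrow> Cinf_on U f \<Longrightarrow> Cinf_on U g \<Longrightarrow> Cinf_on U (\<lambda>x. f x * g x)"
  by (simp add: Cinf_on_def Ck_on_prod[OF bounded_bilinear_mult])

lemma Cinf_on_inner:
  "open U \<Longrightarrow> Cinf_on U f \<Longrightarrow> Cinf_on U g \<Longrightarrow> Cinf_on U (\<lambda>x. f x \<bullet> g x)"
  by (simp add: Cinf_on_def Ck_on_prod[OF bounded_bilinear_inner])

lemma Cinf_on_diff:
  assumes "open U" "Cinf_on U f" "Cinf_on U g" shows "Cinf_on U (\<lambda>x. f x - g x)"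
  using Cinf_on_add[OF assms(1,2) Cinf_on_scaleR[OF assms(1) Cinf_on_const assms(3), of "-1"]] by simp

lemmas Cinf_on_intros =
  Cinf_on_const Cinf_on_add Cinf_on_diff Cinf_on_scaleR Cinf_on_mult Cinf_on_inner Cinf_on_dirD

text \<open>The second difference of \<open>f\<close> along \<open>u\<close> and \<open>v\<close>, which is symmetric in \<open>u\<close> and \<open>v\<close>,
  is by two applications of the mean value theorem a value of the iterated derivative.\<close>

lemma second_difference_mvt:
  fixes f :: "'a::real_normed_vector \<Rightarrow> real"
  assumes f: "\<And>y. y \<in> ball x r \<Longrightarrow> f differentiable (at y)"
    and fu: "\<And>y. y \<in> ball x r \<Longrightarrow> dirD u f differentiable (at y)"
    and h: "0 < h" "h * (norm u + norm v) < r"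
  shows "\<exists>y. dist x y \<le> h * (norm u + norm v) \<and>
    f (x + h *\<^sub>R u + h *\<^sub>R v) - f (x + h *\<^sub>R u) - f (x + h *\<^sub>R v) + f x = h * h * dirD v (dirD u f) y"
proof -
  have dist: "dist x (x + s *\<^sub>R u + t *\<^sub>R v) \<le> h * (norm u + norm v)"
    if "0 \<le> s" "s \<le> h" "0 \<le> t" "t \<le> h" for s t
  proof -
    have "norm (s *\<^sub>R u + t *\<^sub>R v) \<le> s * norm u + t * norm v"
      using that by (intro norm_triangle_le) simp
    also have "\<dots> \<le> h * norm u + h * norm v"
      using that by (intro add_mono mult_right_mono) auto
    finally show ?thesis by (simp add: dist_norm norm_minus_commute algebra_simps)
  qed
  then have inb: "x + s *\<^sub>R u + t *\<^sub>R v \<in> ball x r"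
    if "0 \<le> s" "s \<le> h" "0 \<le> t" "t \<le> h" for s t
    using that h by (force simp del: dist_add_cancel)
  define \<phi> where "\<phi> s = f (x + h *\<^sub>R v + s *\<^sub>R u) - f (x + s *\<^sub>R u)" for s
  have "\<exists>s. 0 < s \<and> s < h \<and>
      \<phi> h - \<phi> 0 = (h - 0) * (dirD u f (x + h *\<^sub>R v + s *\<^sub>R u) - dirD u f (x + s *\<^sub>R u))"
  proof (rule MVT2)
    show "(\<phi> has_real_derivative dirD u f (x + h *\<^sub>R v + s *\<^sub>R u) - dirD u f (x + s *\<^sub>R u)) (at s)"
      if "0 \<le> s" "s \<le> h" for s
      unfolding \<phi>_def has_real_derivative_iff_has_vector_derivative
      using inb[of s h] inb[of s 0] that h(1)
      by (intro has_vector_derivative_diff dirD_line f) (simp_all add: add.commute add.left_commute)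
  qed (use h in auto)
  then obtain s where s: "0 < s" "s < h"
    and s_eq: "\<phi> h - \<phi> 0 = h * (dirD u f (x + h *\<^sub>R v + s *\<^sub>R u) - dirD u f (x + s *\<^sub>R u))"
    by auto
  have "\<exists>t. 0 < t \<and> t < h \<and> dirD u f (x + s *\<^sub>R u + h *\<^sub>R v) - dirD u f (x + s *\<^sub>R u + 0 *\<^sub>R v) =
      (h - 0) * dirD v (dirD u f) (x + s *\<^sub>R u + t *\<^sub>R v)"
  proof (rule MVT2)
    show "((\<lambda>t. dirD u f (x + s *\<^sub>R u + t *\<^sub>R v)) has_real_derivative
        dirD v (dirD u f) (x + s *\<^sub>R u + t *\<^sub>R v)) (at t)" if "0 \<le> t" "t \<le> h" for t
      unfolding has_real_derivative_iff_has_vector_derivative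
      using inb[of s t] that s by (intro dirD_line fu) auto
  qed (use h in auto)
  then obtain t where t: "0 < t" "t < h"
    and t_eq: "dirD u f (x + s *\<^sub>R u + h *\<^sub>R v) - dirD u f (x + s *\<^sub>R u) =
      h * dirD v (dirD u f) (x + s *\<^sub>R u + t *\<^sub>R v)"
    by auto
  have "f (x + h *\<^sub>R u + h *\<^sub>R v) - f (x + h *\<^sub>R u) - f (x + h *\<^sub>R v) + f x = \<phi> h - \<phi> 0"
    by (simp add: \<phi>_def algebra_simps)
  also have "\<dots> = h * h * dirD v (dirD u f) (x + s *\<^sub>R u + t *\<^sub>R v)"
    using s_eq t_eq by (simp add: algebra_simps)
  finally show ?thesis using dist[of s t] s t by (intro exI conjI) auto
qed

lemma dirD_inner_const:
  assumes "f differentiable (at x)"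
  shows "dirD v (\<lambda>x. f x \<bullet> b) x = dirD v f x \<bullet> b"
  using dirD_inner[OF assms differentiable_const[of b], of v] by (simp add: dirD_def)

text \<open>Both iterated derivatives arise from the same second difference, so they take a common
  value at two points near \<open>x\<close>; continuity carries this to \<open>x\<close>.\<close>

lemma dirD_commute_real:
  fixes f :: "'a::euclidean_space \<Rightarrow> real"
  assumes "open U" "x \<in> U" "Cinf_on U f"
  shows "dirD u (dirD v f) x = dirD v (dirD u f) x"
proof (rule ccontr)
  assume neq: "\<not> ?thesis"
  \<comment> \<open>Half the supposed gap: two errors below \<open>e\<close> cannot bridge
    it.\<close>
  define e where "e = \<bar>dirD u (dirD v f) x - dirD v (dirD u f) x\<bar> / 2"
  have e: "e > 0" using neq by (simp add: e_def)
  obtain r0 where r0: "r0 > 0" "ball x r0 \<subseteq> U" using assms openE by blast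
  have cont: "isCont (dirD w (dirD w' f)) x" for w w'
    using Cinf_on_continuous_on[of U "dirD w (dirD w' f)"] assms
    by (simp add: Cinf_on_dirD continuous_on_eq_continuous_at)
  obtain r1 where r1: "r1 > 0" "\<And>y. dist y x < r1 \<Longrightarrow> \<bar>dirD u (dirD v f) y - dirD u (dirD v f) x\<bar> < e"
    using cont[of u v] e unfolding continuous_at_eps_delta dist_real_def by meson
  obtain r2 where r2: "r2 > 0" "\<And>y. dist y x < r2 \<Longrightarrow> \<bar>dirD v (dirD u f) y - dirD v (dirD u f) x\<bar> < e"
    using cont[of v u] e unfolding continuous_at_eps_delta dist_real_def by meson
  define r where "r = Min {r0, r1, r2}"
  have r: "r > 0" "r \<le> r0" "r \<le> r1" "r \<le> r2" using r0 r1 r2 by (auto simp: r_def)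
  define h where "h = r / (norm u + norm v + 1)"
  have nn: "norm u + norm v + 1 > 0" by (simp add: add_nonneg_pos)
  have h: "0 < h" using nn r by (simp add: h_def)
  have hr: "h * (norm u + norm v) < r" 
    using nn r by (simp add: h_def divide_simps mult_less_cancel_left_pos)
  have U: "y \<in> U" if "y \<in> ball x r" for y using that r r0 by auto
  have diff: "f differentiable (at y)" "dirD w f differentiable (at y)" if "y \<in> ball x r" for y w
    using Cinf_on_differentiable Cinf_on_dirD assms(3) U[OF that] by blast+
  obtain y where y: "dist x y \<le> h * (norm u + norm v)"
    "f (x + h *\<^sub>R u + h *\<^sub>R v) - f (x + h *\<^sub>R u) - f (x + h *\<^sub>R v) + f x = h * h * dirD v (dirD u f) y"
    using second_difference_mvt[OF diff h hr] by blast
  have hr': "h * (norm v + norm u) < r" using hr by (simp add: add.commute)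
  obtain z where z: "dist x z \<le> h * (norm v + norm u)"
    "f (x + h *\<^sub>R v + h *\<^sub>R u) - f (x + h *\<^sub>R v) - f (x + h *\<^sub>R u) + f x = h * h * dirD u (dirD v f) z"
    using second_difference_mvt[OF diff h hr'] by blast
  have "h * h * dirD v (dirD u f) y = h * h * dirD u (dirD v f) z"
    using y(2) z(2) by (simp add: algebra_simps)
  then have "dirD v (dirD u f) y = dirD u (dirD v f) z" using h by simp
  moreover have "\<bar>dirD u (dirD v f) z - dirD u (dirD v f) x\<bar> < e"
    using r1(2)[of z] z(1) hr' r by (simp add: dist_commute)
  moreover have "\<bar>dirD v (dirD u f) y - dirD v (dirD u f) x\<bar> < e"
    using r2(2)[of y] y(1) hr r by (simp add: dist_commute)
  moreover have "\<bar>dirD u (dirD v f) x - dirD v (dirD u f) x\<bar> = 2 * e" by (simp add: e_def)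
  ultimately show False by linarith
qed

lemma dirD_commute:
  assumes "open U" "x \<in> U" "Cinf_on U f"
  shows "dirD u (dirD v f) x = dirD v (dirD u f) x"
proof (rule euclidean_eqI)
  fix b :: 'b
  have "dirD u (dirD v f) x \<bullet> b = dirD u (dirD v (\<lambda>x. f x \<bullet> b)) x" for u v
  proof -
    have "dirD u (dirD v (\<lambda>x. f x \<bullet> b)) x = dirD u (\<lambda>x. dirD v f x \<bullet> b) x"
      by (rule dirD_cong[OF assms(1,2)])
        (use assms in \<open>auto simp: dirD_inner_const[OF Cinf_on_differentiable] intro!: differentiable_inner
           Cinf_on_differentiable[OF Cinf_on_dirD]\<close>)
    then show ?thesis
      using assms by (simp add: dirD_inner_const Cinf_on_differentiable[OF Cinf_on_dirD])
  qed
  moreover have "Cinf_on U (\<lambda>x. f x \<bullet> b)" by (intro Cinf_on_intros assms)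
  ultimately show "dirD u (dirD v f) x \<bullet> b = dirD v (dirD u f) x \<bullet> b"
    using dirD_commute_real assms by metis
qed

section \<open>The Ricci equation for immersed surfaces\<close>

text \<open>For the coordinate fields of an immersion, this is the determinant of the induced
  metric.\<close>

definition gram :: "'a::real_inner \<Rightarrow> 'a \<Rightarrow> real" where
  "gram a b = (a \<bullet> a) * (b \<bullet> b) - (a \<bullet> b) * (a \<bullet> b)"

text \<open>By Cramer's rule, \<open>gram a b\<close> times the coefficient of \<open>a\<close> in
  the projection of \<open>w\<close> to the span of \<open>a\<close> and \<open>b\<close>.\<close>

definition cof :: "'a::real_inner \<Rightarrow> 'a \<Rightarrow> 'a \<Rightarrow> real" where
  "cof a b w = (b \<bullet> b) * (w \<bullet> a) - (a \<bullet> b) * (w \<bullet> b)"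

text \<open>For independent \<open>a\<close> and \<open>b\<close>, \<open>gram a b\<close> times the
  projection of \<open>w\<close> to their orthogonal complement. Avoiding division keeps it
  polynomial in \<open>a\<close> and \<open>b\<close>, hence smooth and periodic along an immersed
  torus and easy to differentiate in time.\<close>

definition perp :: "'a::real_inner \<Rightarrow> 'a \<Rightarrow> 'a \<Rightarrow> 'a" where
  "perp a b w = gram a b *\<^sub>R w - cof a b w *\<^sub>R a - cof b a w *\<^sub>R b"

lemma perp_inner: "perp a b w \<bullet> a = 0" "perp a b w \<bullet> b = 0"
  by (simp_all add: perp_def gram_def cof_def inner_diff_left inner_commute algebra_simps)

lemma vec2_expand: "v = v $ 1 *\<^sub>R axis 1 1 + v $ 2 *\<^sub>R axis 2 (1::real)" for v :: "real^2"
  by (simp add: vec_eq_iff forall_2 axis_def)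

abbreviation pd :: "'m \<Rightarrow> (real^'m \<Rightarrow> 'b::real_normed_vector) \<Rightarrow> real^'m \<Rightarrow> 'b" where
  "pd i \<equiv> dirD (axis i 1)"

lemma dirD_vec2:
  fixes f :: "real^2 \<Rightarrow> 'b::real_normed_vector"
  assumes "f differentiable (at x)"
  shows "dirD v f x = v $ 1 *\<^sub>R pd 1 f x + v $ 2 *\<^sub>R pd 2 f x"
  using dirD_add_left[OF assms] dirD_scaleR_left[OF assms] vec2_expand[of v] by metis

lemma dirD_vec_nth:
  assumes "f differentiable (at x)"
  shows "dirD v (\<lambda>x. f x $ i) x = dirD v f x $ i"
  by (rule dirD_eqI) (use bounded_linear.has_derivative[OF bounded_linear_vec_nth has_derivative_dirD[OF assms]] in simp)

lemma dir_deriv_dirD: "dir_deriv Z V x = dirD (Z x) V x"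
  by (simp add: dir_deriv_def dirD_def)

text \<open>Expanding \<open>Y\<close> in the coordinate frame reduces this to the product rule;
  symmetry of second derivatives moves \<open>v\<close> to the inner derivative.\<close>

lemma dirD_dir_deriv:
  fixes \<nu> :: "real^2 \<Rightarrow> real^'n"
  assumes \<nu>: "Cinf_on UNIV \<nu>" and Y: "Y differentiable (at x)"
  shows "dir_deriv Y \<nu> differentiable (at x)"
    and "dirD v (dir_deriv Y \<nu>) x = dirD (Y x) (dirD v \<nu>) x + dirD (dirD v Y x) \<nu> x"
proof -
  have d: "\<nu> differentiable (at y)" "dirD w \<nu> differentiable (at y)" for y w
    using \<nu> Cinf_on_differentiable Cinf_on_dirD by blast+
  have eq: "dir_deriv Y \<nu> = (\<lambda>y. Y y $ 1 *\<^sub>R pd 1 \<nu> y + Y y $ 2 *\<^sub>R pd 2 \<nu> y)"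
    unfolding dir_deriv_def[abs_def] dirD_def[symmetric] using dirD_vec2[OF d(1)] by blast
  have dY: "(\<lambda>x. Y x $ i) differentiable (at x)" for i
    using Y by (simp add: differentiable_componentwise_within[of Y] inner_axis Basis_vec_def)
  show "dir_deriv Y \<nu> differentiable (at x)"
    unfolding eq by (intro differentiable_add differentiable_scaleR dY d)
  have "dirD v (dir_deriv Y \<nu>) x =
      Y x $ 1 *\<^sub>R dirD v (pd 1 \<nu>) x + dirD v Y x $ 1 *\<^sub>R pd 1 \<nu> x +
      (Y x $ 2 *\<^sub>R dirD v (pd 2 \<nu>) x + dirD v Y x $ 2 *\<^sub>R pd 2 \<nu> x)"
    unfolding eq by (simp add: dirD_add dirD_scaleR dY d differentiable_scaleR dirD_vec_nth Y)
  also have "\<dots> = (Y x $ 1 *\<^sub>R pd 1 (dirD v \<nu>) x + Y x $ 2 *\<^sub>R pd 2 (dirD v \<nu>) x) +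
      (dirD v Y x $ 1 *\<^sub>R pd 1 \<nu> x + dirD v Y x $ 2 *\<^sub>R pd 2 \<nu> x)"
    using dirD_commute[OF open_UNIV UNIV_I \<nu>] by (simp add: algebra_simps)
  also have "\<dots> = dirD (Y x) (dirD v \<nu>) x + dirD (dirD v Y x) \<nu> x"
    using dirD_vec2 d by metis
  finally show "dirD v (dir_deriv Y \<nu>) x = dirD (Y x) (dirD v \<nu>) x + dirD (dirD v Y x) \<nu> x" .
qed

text \<open>The second-order terms cancel by symmetry; the derivatives of the fields
  \<open>X\<close> and \<open>Y\<close> remain and form the bracket.\<close>

lemma dir_deriv_commutator:
  fixes \<nu> :: "real^2 \<Rightarrow> real^'n"
  assumes \<nu>: "Cinf_on UNIV \<nu>" and "X differentiable (at x)" "Y differentiable (at x)"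
  shows "dir_deriv X (dir_deriv Y \<nu>) x - dir_deriv Y (dir_deriv X \<nu>) x = dir_deriv (lie_bracket X Y) \<nu> x"
proof -
  have "linear (\<lambda>v. dirD v \<nu> x)"
    unfolding dirD_def using linear_frechet_derivative Cinf_on_differentiable[OF \<nu>] by auto
  note lin = linear_diff[OF this]
  have "dir_deriv X (dir_deriv Y \<nu>) x - dir_deriv Y (dir_deriv X \<nu>) x =
      dirD (Y x) (dirD (X x) \<nu>) x + dirD (dirD (X x) Y x) \<nu> x
      - (dirD (X x) (dirD (Y x) \<nu>) x + dirD (dirD (Y x) X x) \<nu> x)"
    using assms dirD_dir_deriv(2)[OF \<nu>] unfolding dir_deriv_dirD[of _ "dir_deriv _ _"] by simp
  also have "\<dots> = dirD (dirD (X x) Y x - dirD (Y x) X x) \<nu> x"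
    using dirD_commute[OF open_UNIV UNIV_I \<nu>, of "X x" "Y x"] lin by simp
  finally show ?thesis by (simp add: lie_bracket_def dir_deriv_dirD)
qed

section \<open>Tangential and normal projections for an immersed surface\<close>

locale immersed_surface =
  fixes F :: "real^2 \<Rightarrow> real^'n"
  assumes immersion: "torus_immersion F"
begin

lemma smooth: "Cinf_on UNIV F"
  using immersion by (simp add: torus_immersion_def torus_smooth_def)

lemma differentiable: "F differentiable (at x)" "dirD v F differentiable (at x)"
  "dirD u (dirD v F) differentiable (at x)"
  using smooth Cinf_on_differentiable Cinf_on_dirD by blast+

lemma pd_pd_commute: "pd i (pd j F) x = pd j (pd i F) x"
  using dirD_commute[OF open_UNIV UNIV_I smooth] .

lemma tangent_space_eq: "tangent_space F x = {s *\<^sub>R pd 1 F x + t *\<^sub>R pd 2 F x | s t. True}"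
proof -
  have "\<exists>v::real^2. v $ 1 = s \<and> v $ 2 = t" for s t :: real
    by (rule exI[of _ "s *\<^sub>R axis 1 1 + t *\<^sub>R axis 2 1"]) (simp add: axis_def)
  then show ?thesis
    unfolding tangent_space_def dirD_def[symmetric, abs_def] image_def
    using dirD_vec2[OF differentiable(1), unfolded dirD_def] dirD_def by (metis (no_types, lifting) UNIV_I)
qed

lemma normal_space_iff: "\<nu> \<in> normal_space F x \<longleftrightarrow> \<nu> \<bullet> pd 1 F x = 0 \<and> \<nu> \<bullet> pd 2 F x = 0"
proof
  assume "\<nu> \<in> normal_space F x"
  moreover have "s *\<^sub>R pd 1 F x + t *\<^sub>R pd 2 F x \<in> tangent_space F x" for s t
    by (auto simp: tangent_space_eq)
  ultimately have "(s *\<^sub>R pd 1 F x + t *\<^sub>R pd 2 F x) \<bullet> \<nu> = 0" for s t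
    unfolding normal_space_def orthogonal_comp_def orthogonal_def by blast
  from this[of 1 0] this[of 0 1] show "\<nu> \<bullet> pd 1 F x = 0 \<and> \<nu> \<bullet> pd 2 F x = 0"
    by (simp add: inner_commute)
qed (auto simp: normal_space_def orthogonal_comp_def tangent_space_eq orthogonal_def inner_add_right
    inner_commute[of _ \<nu>])

text \<open>Multiplied by \<open>?b \<bullet> ?b\<close>, the determinant is the squared length of
  an unnormalised Gram-Schmidt vector. That vector is nonzero, being the image of a nonzero vector
  under the injective differential.\<close>

lemma gram_pos: "gram (pd 1 F x) (pd 2 F x) > 0"
proof -
  let ?a = "pd 1 F x" and ?b = "pd 2 F x"
  have inj: "dirD v F x = 0 \<Longrightarrow> v = 0" for v
    using immersion linear_injective_0[OF linear_frechet_derivative[OF differentiable(1)], of x]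
    unfolding torus_immersion_def dirD_def by blast
  have "?b \<noteq> 0" using inj[of "axis 2 1"] by auto
  have "(?b \<bullet> ?b) *\<^sub>R ?a - (?a \<bullet> ?b) *\<^sub>R ?b \<noteq> 0"
  proof
    assume "(?b \<bullet> ?b) *\<^sub>R ?a - (?a \<bullet> ?b) *\<^sub>R ?b = 0"
    then have "dirD ((?b \<bullet> ?b) *\<^sub>R axis 1 1 + (- (?a \<bullet> ?b)) *\<^sub>R axis 2 1) F x = 0"
      using differentiable(1) by (simp only: dirD_add_left dirD_scaleR_left) simp
    from arg_cong[OF inj[OF this], of "\<lambda>v. v $ 1"] have "?b \<bullet> ?b = 0" by (simp add: axis_def)
    with \<open>?b \<noteq> 0\<close> show False by simp
  qed
  then have "0 < ((?b \<bullet> ?b) *\<^sub>R ?a - (?a \<bullet> ?b) *\<^sub>R ?b) \<bullet> ((?b \<bullet> ?b) *\<^sub>R ?a - (?a \<bullet> ?b) *\<^sub>R ?b)"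
    using inner_gt_zero_iff by blast
  also have "\<dots> = (?b \<bullet> ?b) * gram ?a ?b"
    by (simp add: gram_def inner_diff_left inner_diff_right inner_commute algebra_simps)
  finally show ?thesis using inner_ge_zero[of ?b] by (auto simp: zero_less_mult_iff)
qed

text \<open>Together with \<open>tang2\<close>, the coordinates of the tangential part of
  \<open>w\<close> in the frame of the coordinate fields.\<close>

definition tang1 :: "real^2 \<Rightarrow> real^'n \<Rightarrow> real" where
  "tang1 x w = cof (pd 1 F x) (pd 2 F x) w / gram (pd 1 F x) (pd 2 F x)"

definition tang2 :: "real^2 \<Rightarrow> real^'n \<Rightarrow> real" where
  "tang2 x w = cof (pd 2 F x) (pd 1 F x) w / gram (pd 1 F x) (pd 2 F x)"

text \<open>Two candidates differ by a vector that is both tangent and normal, hence orthogonal to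
  itself. This resolves the definite description in \<open>normal_part\<close>.\<close>

lemma normal_part_unique:
  assumes "\<nu> \<in> normal_space F x" "w - \<nu> \<in> tangent_space F x"
  shows "normal_part F x w = \<nu>"
  unfolding normal_part_def
proof (rule the_equality)
  fix \<mu> assume \<mu>: "\<mu> \<in> normal_space F x \<and> w - \<mu> \<in> tangent_space F x"
  obtain s t where "w - \<nu> = s *\<^sub>R pd 1 F x + t *\<^sub>R pd 2 F x" using assms(2) tangent_space_eq by auto
  moreover obtain s' t' where "w - \<mu> = s' *\<^sub>R pd 1 F x + t' *\<^sub>R pd 2 F x" using \<mu> tangent_space_eq by auto
  ultimately have eq: "\<mu> - \<nu> = (s - s') *\<^sub>R pd 1 F x + (t - t') *\<^sub>R pd 2 F x"
    by (simp add: algebra_simps)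
  have "(\<mu> - \<nu>) \<bullet> ((s - s') *\<^sub>R pd 1 F x + (t - t') *\<^sub>R pd 2 F x) = 0"
    using \<mu> assms(1) by (simp add: normal_space_iff inner_diff_left inner_add_right)
  then show "\<mu> = \<nu>" unfolding eq[symmetric] by simp
qed (use assms in simp)

lemma residual_normal: "w - tang1 x w *\<^sub>R pd 1 F x - tang2 x w *\<^sub>R pd 2 F x \<in> normal_space F x"
proof -
  let ?\<Delta> = "gram (pd 1 F x) (pd 2 F x)"
  have "w - tang1 x w *\<^sub>R pd 1 F x - tang2 x w *\<^sub>R pd 2 F x = (1 / ?\<Delta>) *\<^sub>R perp (pd 1 F x) (pd 2 F x) w"
    using gram_pos[of x] by (simp add: tang1_def tang2_def perp_def scaleR_diff_right)
  then show ?thesis by (simp add: normal_space_iff perp_inner)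
qed

lemma normal_part_eq: "normal_part F x w = w - tang1 x w *\<^sub>R pd 1 F x - tang2 x w *\<^sub>R pd 2 F x"
  by (rule normal_part_unique[OF residual_normal]) (auto simp: tangent_space_eq algebra_simps)

lemma normal_part_normal: "normal_part F x w \<in> normal_space F x"
  using residual_normal normal_part_eq by simp

lemma tang_linear: "linear (tang1 x)" "linear (tang2 x)"
  by (auto intro!: linearI simp: tang1_def tang2_def cof_def inner_add_left algebra_simps add_divide_distrib[symmetric])

lemma linear_normal_part: "linear (normal_part F x)"
  by (rule linearI) (simp_all add: normal_part_eq linear_add[OF tang_linear(1)] linear_add[OF tang_linear(2)]
      linear_scale[OF tang_linear(1)] linear_scale[OF tang_linear(2)] algebra_simps)

lemma normal_part_tangent: "normal_part F x (pd 1 F x) = 0" "normal_part F x (pd 2 F x) = 0"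
proof -
  have "s *\<^sub>R pd 1 F x + t *\<^sub>R pd 2 F x \<in> tangent_space F x" for s t
    by (auto simp: tangent_space_eq)
  from this[of 1 0] this[of 0 1]
  show "normal_part F x (pd 1 F x) = 0" "normal_part F x (pd 2 F x) = 0"
    by (auto intro!: normal_part_unique simp: normal_space_iff)
qed

lemma normal_part_inner: "\<nu> \<in> normal_space F x \<Longrightarrow> normal_part F x w \<bullet> \<nu> = w \<bullet> \<nu>"
  by (simp add: normal_part_eq normal_space_iff inner_diff_right inner_commute[of _ \<nu>])

lemma tang_differentiable:
  assumes "V differentiable (at x)"
  shows "(\<lambda>x. tang1 x (V x)) differentiable (at x)" "(\<lambda>x. tang2 x (V x)) differentiable (at x)"
proof -
  have ne: "gram (pd 1 F x) (pd 2 F x) \<noteq> 0" using gram_pos[of x] by simp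
  have g: "(\<lambda>x. gram (pd 1 F x) (pd 2 F x)) differentiable (at x)"
    unfolding gram_def by (intro differentiable_diff differentiable_mult differentiable_inner differentiable)
  show "(\<lambda>x. tang1 x (V x)) differentiable (at x)" "(\<lambda>x. tang2 x (V x)) differentiable (at x)"
    unfolding tang1_def tang2_def cof_def
    by (intro differentiable_divide g ne differentiable_diff differentiable_mult differentiable_inner
        differentiable assms)+
qed

text \<open>Terms in which the tangential coefficients are differentiated are multiples of the
  coordinate fields, so the outer projection kills them and these derivatives never have to be
  computed.\<close>

lemma normal_connection_twice:
  assumes \<nu>: "torus_smooth \<nu>" and XY: "torus_smooth X" "torus_smooth Y"
  shows "normal_connection F X (normal_connection F Y \<nu>) x = normal_part F x (dir_deriv X (dir_deriv Y \<nu>) x)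
     - tang1 x (dir_deriv Y \<nu> x) *\<^sub>R normal_part F x (dir_deriv X (pd 1 F) x)
     - tang2 x (dir_deriv Y \<nu> x) *\<^sub>R normal_part F x (dir_deriv X (pd 2 F) x)"
proof -
  have d: "dir_deriv Y \<nu> differentiable (at x)"
    using \<nu> XY by (intro dirD_dir_deriv Cinf_on_differentiable[of UNIV]) (auto simp: torus_smooth_def)
  have "normal_connection F Y \<nu> =
      (\<lambda>x. dir_deriv Y \<nu> x - tang1 x (dir_deriv Y \<nu> x) *\<^sub>R pd 1 F x - tang2 x (dir_deriv Y \<nu> x) *\<^sub>R pd 2 F x)"
    by (simp add: fun_eq_iff normal_connection_def normal_part_eq)
  moreover have "dirD v \<dots> x = dirD v (dir_deriv Y \<nu>) x
      - (tang1 x (dir_deriv Y \<nu> x) *\<^sub>R dirD v (pd 1 F) x + dirD v (\<lambda>x. tang1 x (dir_deriv Y \<nu> x)) x *\<^sub>R pd 1 F x)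
      - (tang2 x (dir_deriv Y \<nu> x) *\<^sub>R dirD v (pd 2 F) x + dirD v (\<lambda>x. tang2 x (dir_deriv Y \<nu> x)) x *\<^sub>R pd 2 F x)" for v
    by (rule dirD_eqI)
      (intro has_derivative_diff has_derivative_scaleR has_derivative_dirD d tang_differentiable differentiable)
  ultimately have "normal_connection F X (normal_connection F Y \<nu>) x =
    normal_part F x (dir_deriv X (dir_deriv Y \<nu>) x
      - (tang1 x (dir_deriv Y \<nu> x) *\<^sub>R dir_deriv X (pd 1 F) x + dirD (X x) (\<lambda>x. tang1 x (dir_deriv Y \<nu> x)) x *\<^sub>R pd 1 F x)
      - (tang2 x (dir_deriv Y \<nu> x) *\<^sub>R dir_deriv X (pd 2 F) x + dirD (X x) (\<lambda>x. tang2 x (dir_deriv Y \<nu> x)) x *\<^sub>R pd 2 F x))"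
    by (simp only: normal_connection_def[of F X] dir_deriv_dirD[of X])
  then show ?thesis
    by (simp only: linear_diff[OF linear_normal_part] linear_add[OF linear_normal_part]
        linear_scale[OF linear_normal_part] normal_part_tangent) simp
qed

text \<open>The Ricci equation: since the Euclidean connection is flat, only the tangential parts of
  the derivatives of \<open>\<nu>\<close> contribute to the normal curvature.\<close>

lemma normal_curvature_eq:
  assumes \<nu>: "torus_smooth \<nu>" and XY: "torus_smooth X" "torus_smooth Y"
  shows "normal_curvature F X Y \<nu> x =
       tang1 x (dir_deriv X \<nu> x) *\<^sub>R normal_part F x (dir_deriv Y (pd 1 F) x)
     + tang2 x (dir_deriv X \<nu> x) *\<^sub>R normal_part F x (dir_deriv Y (pd 2 F) x)
     - tang1 x (dir_deriv Y \<nu> x) *\<^sub>R normal_part F x (dir_deriv X (pd 1 F) x)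
     - tang2 x (dir_deriv Y \<nu> x) *\<^sub>R normal_part F x (dir_deriv X (pd 2 F) x)"
proof -
  have "dir_deriv X (dir_deriv Y \<nu>) x - dir_deriv Y (dir_deriv X \<nu>) x = dir_deriv (lie_bracket X Y) \<nu> x"
    using \<nu> XY by (intro dir_deriv_commutator Cinf_on_differentiable[of UNIV]) (auto simp: torus_smooth_def)
  then have "normal_part F x (dir_deriv X (dir_deriv Y \<nu>) x) - normal_part F x (dir_deriv Y (dir_deriv X \<nu>) x)
      = normal_connection F (lie_bracket X Y) \<nu> x"
    unfolding normal_connection_def by (simp add: linear_diff[OF linear_normal_part, symmetric])
  then show ?thesis
    unfolding normal_curvature_def
      normal_connection_twice[OF \<nu> XY] normal_connection_twice[OF \<nu> XY(2,1)]
    by (simp add: algebra_simps)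
qed

text \<open>The Weingarten relation: differentiate the orthogonality of \<nu> to a coordinate
  field.\<close>

lemma inner_dirD_normal:
  assumes "torus_smooth \<nu>" "\<And>x. \<nu> x \<in> normal_space F x"
  shows "dirD v \<nu> x \<bullet> pd i F x = - (\<nu> x \<bullet> dirD v (pd i F) x)"
proof -
  have d: "\<nu> differentiable (at x)"
    using assms(1) Cinf_on_differentiable[of UNIV] by (auto simp: torus_smooth_def)
  have "\<nu> y \<bullet> pd i F y = 0" for y
    using assms(2)[of y] exhaust_2[of i] by (auto simp: normal_space_iff)
  then have "dirD v (\<lambda>y. \<nu> y \<bullet> pd i F y) x = 0" by (simp add: dirD_def)
  then show ?thesis by (simp add: dirD_inner d differentiable)
qed

text \<open>The mixed derivative is tangent, so the second fundamental form is diagonal in an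
  orthogonal frame. The tangential coefficients of the derivative of \<nu> along \<open>Z\<close>
  then scale with the matching components of \<open>Z\<close>, and the four terms of the Ricci
  equation cancel in pairs.\<close>

lemma flat_if_principal_coordinates:
  assumes g12: "\<And>x. pd 1 F x \<bullet> pd 2 F x = 0"
    and F12: "\<And>x. pd 1 (pd 2 F) x = l x *\<^sub>R pd 1 F x"
  shows "flat_normal_bundle F"
  unfolding flat_normal_bundle_def
proof (intro allI impI)
  fix X Y :: "real^2 \<Rightarrow> real^2" and \<nu> x
  assume XY: "torus_smooth X" "torus_smooth Y" and \<nu>: "torus_smooth \<nu>" "\<forall>x. \<nu> x \<in> normal_space F x"
  note lin = linear_add[OF linear_normal_part] linear_scale[OF linear_normal_part]
  have F21: "pd 2 (pd 1 F) x = l x *\<^sub>R pd 1 F x" using F12 pd_pd_commute by simp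
  have \<nu>n: "\<nu> x \<bullet> pd 1 F x = 0" "\<nu> x \<bullet> pd 2 F x = 0" using \<nu>(2) normal_space_iff by auto
  have n: "normal_part F x (dir_deriv Z (pd 1 F) x) = Z x $ 1 *\<^sub>R normal_part F x (pd 1 (pd 1 F) x)"
    "normal_part F x (dir_deriv Z (pd 2 F) x) = Z x $ 2 *\<^sub>R normal_part F x (pd 2 (pd 2 F) x)" for Z
    unfolding dir_deriv_dirD dirD_vec2[OF differentiable(2), of "Z x"] by (simp_all add: lin F12 F21 normal_part_tangent)
  have i: "dir_deriv Z \<nu> x \<bullet> pd 1 F x = - (Z x $ 1 * (\<nu> x \<bullet> pd 1 (pd 1 F) x))"
    "dir_deriv Z \<nu> x \<bullet> pd 2 F x = - (Z x $ 2 * (\<nu> x \<bullet> pd 2 (pd 2 F) x))" for Z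
    unfolding dir_deriv_dirD using inner_dirD_normal[OF \<nu>(1)] \<nu>(2) dirD_vec2[OF differentiable(2), of "Z x"]
    by (simp_all add: inner_add_right F12 F21 \<nu>n)
  have t: "tang1 x (dir_deriv Z \<nu> x) = Z x $ 1 * tang1 x (dir_deriv (\<lambda>_. axis 1 1) \<nu> x)"
    "tang2 x (dir_deriv Z \<nu> x) = Z x $ 2 * tang2 x (dir_deriv (\<lambda>_. axis 2 1) \<nu> x)" for Z
    unfolding tang1_def tang2_def cof_def i using g12 by (simp_all add: inner_commute)
  show "normal_curvature F X Y \<nu> x = 0"
    unfolding normal_curvature_eq[OF \<nu>(1) XY] n t[of X] t[of Y] by (simp add: mult.commute mult.left_commute)
qed

end

text \<open>The \<open>(\<nu>, \<mu>)\<close> component of the normal curvature, multiplied by the determinant of the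
  induced metric, for vectors \<open>\<nu>\<close> and \<open>\<mu>\<close> normal to \<open>a = \<partial>\<^sub>1F\<close> and \<open>b = \<partial>\<^sub>2F\<close>, where
  \<open>c\<close>, \<open>d\<close>, \<open>e\<close> are the second derivatives \<open>\<partial>\<^sub>1\<^sub>1F\<close>, \<open>\<partial>\<^sub>1\<^sub>2F\<close>, \<open>\<partial>\<^sub>2\<^sub>2F\<close>.\<close>

definition ricci_form :: "'a::real_inner \<Rightarrow> 'a \<Rightarrow> 'a \<Rightarrow> 'a \<Rightarrow> 'a \<Rightarrow> 'a \<Rightarrow> 'a \<Rightarrow> real" where
  "ricci_form a b c d e \<nu> \<mu> =
     (b \<bullet> b) * ((\<nu> \<bullet> d) * (\<mu> \<bullet> c) - (\<nu> \<bullet> c) * (\<mu> \<bullet> d))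
   + (a \<bullet> a) * ((\<nu> \<bullet> e) * (\<mu> \<bullet> d) - (\<nu> \<bullet> d) * (\<mu> \<bullet> e))
   - (a \<bullet> b) * ((\<nu> \<bullet> e) * (\<mu> \<bullet> c) - (\<nu> \<bullet> c) * (\<mu> \<bullet> e))"

lemma periodic_dirD:
  assumes "periodic f" "\<And>x. f differentiable (at x)"
  shows "periodic (dirD v f)"
  unfolding periodic_def
proof (intro allI impI)
  fix x k :: "real^'a" assume k: "\<forall>i. k $ i \<in> \<int>"
  have "((\<lambda>y. f (y + k)) has_derivative (\<lambda>v. dirD v f (x + k))) (at x)"
    by (rule has_derivative_compose[of "\<lambda>y. y + k" "\<lambda>v. v", OF _ has_derivative_dirD[OF assms(2)], simplified])
      (auto intro!: derivative_eq_intros)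
  moreover have "(\<lambda>y. f (y + k)) = f" using assms(1) k by (auto simp: periodic_def)
  ultimately show "dirD v f (x + k) = dirD v f x" by (simp add: dirD_eqI)
qed

context immersed_surface
begin

text \<open>Applying \<open>perp\<close> to a constant vector gives a global smooth normal section,
  on which flatness can be tested. Pairing the curvature of the coordinate fields with a normal
  vector and clearing the denominator \<open>?\<Delta>\<close> leaves
  \<open>ricci_form\<close>.\<close>

lemma ricci_form_eq_0_if_flat:
  assumes flat: "flat_normal_bundle F"
  shows "ricci_form (pd 1 F x) (pd 2 F x) (pd 1 (pd 1 F) x) (pd 1 (pd 2 F) x) (pd 2 (pd 2 F) x)
     (perp (pd 1 F x) (pd 2 F x) w) (perp (pd 1 F x) (pd 2 F x) w') = 0"
proof -
  define \<nu> where "\<nu> = (\<lambda>x. perp (pd 1 F x) (pd 2 F x) w)"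
  define \<mu> where "\<mu> = perp (pd 1 F x) (pd 2 F x) w'"
  have \<nu>n: "\<nu> y \<in> normal_space F y" for y by (simp add: \<nu>_def normal_space_iff perp_inner)
  have \<mu>: "\<mu> \<in> normal_space F x" by (simp add: \<mu>_def normal_space_iff perp_inner)
  have "periodic (pd i F)" for i
    using immersion periodic_dirD differentiable(1) by (auto simp: torus_immersion_def torus_smooth_def)
  then have "periodic \<nu>" unfolding \<nu>_def periodic_def by simp
  moreover have "Cinf_on UNIV \<nu>"
    unfolding \<nu>_def perp_def gram_def cof_def by (intro Cinf_on_intros open_UNIV smooth)
  ultimately have \<nu>: "torus_smooth \<nu>" by (simp add: torus_smooth_def)
  have const: "torus_smooth (\<lambda>_. axis i 1 :: real^2)" for i
    by (simp add: torus_smooth_def periodic_def Cinf_on_const)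
  have eq: "dir_deriv (\<lambda>_. axis i 1) V y = pd i V y" for i and V :: "real^2 \<Rightarrow> real^'k" and y
    by (simp add: dir_deriv_def dirD_def)
  let ?\<Delta> = "gram (pd 1 F x) (pd 2 F x)"
  have "0 = ?\<Delta> * (normal_curvature F (\<lambda>_. axis 1 1) (\<lambda>_. axis 2 1) \<nu> x \<bullet> \<mu>)"
    using flat[unfolded flat_normal_bundle_def, rule_format, OF const const \<nu> \<nu>n] by simp
  also have "\<dots> = (?\<Delta> * tang1 x (pd 1 \<nu> x)) * (pd 2 (pd 1 F) x \<bullet> \<mu>)
      + (?\<Delta> * tang2 x (pd 1 \<nu> x)) * (pd 2 (pd 2 F) x \<bullet> \<mu>)
      - (?\<Delta> * tang1 x (pd 2 \<nu> x)) * (pd 1 (pd 1 F) x \<bullet> \<mu>)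
      - (?\<Delta> * tang2 x (pd 2 \<nu> x)) * (pd 1 (pd 2 F) x \<bullet> \<mu>)"
    unfolding normal_curvature_eq[OF \<nu> const const] eq
    by (simp add: inner_diff_left inner_add_left normal_part_inner[OF \<mu>] algebra_simps)
  also have "\<dots> = ricci_form (pd 1 F x) (pd 2 F x) (pd 1 (pd 1 F) x) (pd 1 (pd 2 F) x) (pd 2 (pd 2 F) x) (\<nu> x) \<mu>"
  proof -
    have "?\<Delta> * tang1 x u = cof (pd 1 F x) (pd 2 F x) u" "?\<Delta> * tang2 x u = cof (pd 2 F x) (pd 1 F x) u" for u
      using gram_pos[of x] by (simp_all add: tang1_def tang2_def)
    then show ?thesis
      by (simp add: cof_def inner_dirD_normal[OF \<nu> \<nu>n] pd_pd_commute[of 2 1] ricci_form_def)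
        (simp add: inner_commute algebra_simps)
  qed
  finally show ?thesis by (simp add: \<nu>_def \<mu>_def)
qed

end

section \<open>Time derivatives at the start of the flow\<close>

text \<open>Chain rule for the inclusion of the slice at time \<open>t\<close>.\<close>

lemma dirD_slice:
  fixes G :: "'a::euclidean_space \<times> real \<Rightarrow> 'b::euclidean_space"
  assumes U: "open U" "(x, t) \<in> U" and G: "Cinf_on U G" and f: "\<And>y. (y, t) \<in> U \<Longrightarrow> f y = G (y, t)"
  shows "f differentiable (at x)" "dirD v f x = dirD (v, 0) G (x, t)"
proof -
  have "open ((\<lambda>y. (y, t)) -` U)"
    by (intro continuous_open_vimage continuous_intros U allI) 
  moreover have "((\<lambda>y. G (y, t)) has_derivative (\<lambda>v. dirD (v, 0) G (x, t))) (at x)"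
    by (rule has_derivative_compose[of "\<lambda>y. (y, t)" "\<lambda>v. (v, 0)",
          OF _ has_derivative_dirD[OF Cinf_on_differentiable[OF G U(2)]]])
      (auto intro!: derivative_eq_intros)
  ultimately have "(f has_derivative (\<lambda>v. dirD (v, 0) G (x, t))) (at x)"
    using f U(2) by (elim has_derivative_transform_within_open) auto
  then show "f differentiable (at x)" "dirD v f x = dirD (v, 0) G (x, t)"
    using dirD_eqI unfolding differentiable_def by blast+
qed

text \<open>Makes one-sided derivatives at the initial time unique.\<close>

lemma at_0_within_half_open: "T > 0 \<Longrightarrow> at (0::real) within {0..<T} \<noteq> bot"
proof -
  have "{0..<T} - {0} = {0<..<T}" by auto
  then show "T > 0 \<Longrightarrow> ?thesis" by (simp add: at_within_eq_bot_iff)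
qed

text \<open>The time derivative of a spatial derivative is computed on a smooth extension across \<open>t = 0\<close>,
  where the derivatives commute.\<close>

lemma mean_curvature_flow_derivatives:
  fixes F :: "real \<Rightarrow> real^'m \<Rightarrow> real^'n"
  assumes flow: "mean_curvature_flow F0 T F"
  defines "H \<equiv> mean_curvature F0"
  shows "H differentiable (at x)" "dirD v H differentiable (at x)"
    and "((\<lambda>t. dirD v (F t) x) has_vector_derivative dirD v H x) (at 0 within {0..<T})"
    and "((\<lambda>t. dirD u (dirD v (F t)) x) has_vector_derivative dirD u (dirD v H) x) (at 0 within {0..<T})"
proof -
  have T: "T > 0" and F0: "F 0 = F0"
    and F_t: "((\<lambda>s. F s y) has_vector_derivative H y) (at 0 within {0..<T})" for y
    using flow by (auto simp: mean_curvature_flow_def H_def)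
  obtain U G where U: "open U" "(x, 0) \<in> U" and G: "Cinf_on U G"
    and FG: "\<And>y t. (y, t) \<in> U \<Longrightarrow> 0 \<le> t \<Longrightarrow> t < T \<Longrightarrow> F t y = G (y, t)"
  proof -
    have "smooth_on (UNIV \<times> {0..<T}) (\<lambda>(x, t). F t x)" "(x, 0) \<in> UNIV \<times> {0..<T}"
      using flow T by (auto simp: mean_curvature_flow_def)
    then have "\<exists>U G. open U \<and> (x, 0) \<in> U \<and> Cinf_on U G \<and>
        (\<forall>z\<in>(UNIV \<times> {0..<T}) \<inter> U. G z = (\<lambda>(x, t). F t x) z)"
      unfolding smooth_on_def by (rule bspec)
    then obtain U G where UG: "open U" "(x, 0) \<in> U" "Cinf_on U G"
      and eq: "\<forall>z\<in>(UNIV \<times> {0..<T}) \<inter> U. G z = (\<lambda>(x, t). F t x) z"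
      by (elim exE conjE)
    show ?thesis
    proof (rule that[OF UG])
      show "F t y = G (y, t)" if "(y, t) \<in> U" "0 \<le> t" "t < T" for y t
        using bspec[OF eq, of "(y, t)"] that by simp
    qed
  qed
  let ?\<tau> = "(0 :: real^'m, 1 :: real)"
  have near: "\<exists>e>0. \<forall>t. \<bar>t\<bar> < e \<longrightarrow> (y, t) \<in> U" if y: "(y, 0) \<in> U" for y
  proof -
    obtain e where "e > 0" "ball (y, 0) e \<subseteq> U" by (rule openE[OF U(1) y])
    moreover have "(y, t) \<in> ball (y, 0) e" if "\<bar>t\<bar> < e" for t
      using that by (simp add: dist_Pair_Pair)
    ultimately show ?thesis by blast
  qed
  \<comment> \<open>The time derivative of the extension restricts to a one-sided derivative of
    \<open>f\<close>, since the two agree only for times in \<open>[0, T)\<close>.\<close>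
  have time: "(f has_vector_derivative dirD ?\<tau> G' (y, 0)) (at 0 within {0..<T})"
    if y: "(y, 0) \<in> U" and G': "Cinf_on U G'" and f: "\<And>t. (y, t) \<in> U \<Longrightarrow> 0 \<le> t \<Longrightarrow> t < T \<Longrightarrow> f t = G' (y, t)"
    for f y and G' :: "(real^'m) \<times> real \<Rightarrow> real^'n"
  proof -
    obtain e where e: "e > 0" "\<And>t. \<bar>t\<bar> < e \<Longrightarrow> (y, t) \<in> U"
      using near[OF y] by blast
    have "((\<lambda>s. G' ((y, 0) + s *\<^sub>R ?\<tau>)) has_vector_derivative dirD ?\<tau> G' ((y, 0) + 0 *\<^sub>R ?\<tau>))
        (at 0 within {0..<T})"
      using y G' by (intro dirD_line Cinf_on_differentiable[of U]) auto
    then have "((\<lambda>s. G' (y, s)) has_vector_derivative dirD ?\<tau> G' (y, 0)) (at 0 within {0..<T})"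
      by (simp add: zero_prod_def[symmetric])
    then show ?thesis
      by (rule has_vector_derivative_transform_within[OF _ e(1)]) (use e(2) f T in auto)
  qed
  note triv = at_0_within_half_open[OF T]
  \<comment> \<open>By the flow equation the mean curvature vector is the initial velocity. Near
    \<open>x\<close> it is thus a derivative of the smooth extension, which gives its
    differentiability without any formula for it.\<close>
  have H: "H y = dirD ?\<tau> G (y, 0)" if "(y, 0) \<in> U" for y
    by (rule vector_derivative_unique_within[OF triv F_t time[OF that G]]) (use FG in auto)
  have DG: "Cinf_on U (dirD v G)" for v by (rule Cinf_on_dirD[OF G])
  show "H differentiable (at x)" by (rule dirD_slice(1)[OF U DG H])
  have DH: "dirD v H y = dirD (v, 0) (dirD ?\<tau> G) (y, 0)" if "(y, 0) \<in> U" for y v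
    by (rule dirD_slice(2)[OF U(1) that DG H])
  show "dirD v H differentiable (at x)" by (rule dirD_slice(1)[OF U Cinf_on_dirD[OF DG] DH])
  have DF: "dirD v (F t) y = dirD (v, 0) G (y, t)" if "(y, t) \<in> U" "0 \<le> t" "t < T" for y t v
    by (rule dirD_slice(2)[OF U(1) that(1) G]) (use FG that in auto)
  have DDF: "dirD u (dirD v (F t)) y = dirD (u, 0) (dirD (v, 0) G) (y, t)"
    if "(y, t) \<in> U" "0 \<le> t" "t < T" for y t
    by (rule dirD_slice(2)[OF U(1) that(1) DG]) (use DF that in auto)
  have comm: "dirD a (dirD b G') y = dirD b (dirD a G') y"
    if "y \<in> U" "Cinf_on U G'" for a b y and G' :: "(real^'m) \<times> real \<Rightarrow> real^'n"
    using dirD_commute[OF U(1) that] .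
  show "((\<lambda>t. dirD v (F t) x) has_vector_derivative dirD v H x) (at 0 within {0..<T})"
    unfolding DH[OF U(2)] comm[OF U(2) G, of "(v, 0)"] by (rule time[OF U(2) DG DF])
  have "dirD u (dirD v H) x = dirD (u, 0) (dirD (v, 0) (dirD ?\<tau> G)) (x, 0)"
    by (rule dirD_slice(2)[OF U Cinf_on_dirD[OF DG] DH])
  also have "\<dots> = dirD (u, 0) (dirD ?\<tau> (dirD (v, 0) G)) (x, 0)"
    by (rule dirD_cong[OF U Cinf_on_differentiable[OF Cinf_on_dirD[OF DG] U(2)] comm[OF _ G]])
  also have "\<dots> = dirD ?\<tau> (dirD (u, 0) (dirD (v, 0) G)) (x, 0)"
    by (rule comm[OF U(2) DG])
  finally have DDH: "dirD u (dirD v H) x = dirD ?\<tau> (dirD (u, 0) (dirD (v, 0) G)) (x, 0)" .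
  show "((\<lambda>t. dirD u (dirD v (F t)) x) has_vector_derivative dirD u (dirD v H) x) (at 0 within {0..<T})"
    unfolding DDH by (rule time[OF U(2) Cinf_on_dirD[OF DG] DDF])
qed

section \<open>First-order change of the normal curvature in time\<close>

lemma has_real_derivative_inner:
  assumes "(f has_vector_derivative f') (at x within S)" "(g has_vector_derivative g') (at x within S)"
  shows "((\<lambda>t. f t \<bullet> g t) has_real_derivative f x \<bullet> g' + f' \<bullet> g x) (at x within S)"
  unfolding has_real_derivative_iff_has_vector_derivative
  using bounded_bilinear.has_vector_derivative[OF bounded_bilinear_inner assms] .

text \<open>At \<open>s\<close> the products of \<nu> with \<open>d\<close> vanish, and
  \<open>a \<bullet> b\<close> vanishes to first order, so only terms differentiating a product of
  \<nu> with \<open>d\<close> survive. As \<open>d\<close> is a multiple of \<open>a\<close> there,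
  the unknown derivative of \<nu> enters only through its product with \<open>a\<close>, which the
  orthogonality of \<nu> and \<open>a\<close> fixes. This produces the correction
  \<open>l *\<^sub>R a'\<close> in \<open>P\<close>.\<close>

lemma ricci_form_has_derivative:
  fixes a b c d e :: "real \<Rightarrow> 'a::euclidean_space"
  assumes der: "(a has_vector_derivative a') (at s within S)" "(b has_vector_derivative b') (at s within S)"
      "(c has_vector_derivative c') (at s within S)" "(d has_vector_derivative d') (at s within S)"
      "(e has_vector_derivative e') (at s within S)"
    and S: "at s within S \<noteq> bot"
    and orth: "a s \<bullet> b s = 0" "a s \<bullet> b' + a' \<bullet> b s = 0"
    and d: "d s = l *\<^sub>R a s"
  defines "\<nu> \<equiv> \<lambda>w t. perp (a t) (b t) w"
    and "P \<equiv> \<lambda>w. perp (a s) (b s) w \<bullet> (d' - l *\<^sub>R a')"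
  shows "((\<lambda>t. ricci_form (a t) (b t) (c t) (d t) (e t) (\<nu> w t) (\<nu> w' t)) has_real_derivative
      (b s \<bullet> b s) * (P w * (\<nu> w' s \<bullet> c s) - (\<nu> w s \<bullet> c s) * P w')
    + (a s \<bullet> a s) * ((\<nu> w s \<bullet> e s) * P w' - P w * (\<nu> w' s \<bullet> e s))) (at s within S)"
proof -
  have "\<exists>\<nu>'. (\<nu> w has_vector_derivative \<nu>') (at s within S)" for w
  proof -
    have "\<nu> w differentiable (at s within S)"
      unfolding \<nu>_def perp_def gram_def cof_def
      using der by (intro differentiable_diff differentiable_scaleR differentiable_mult differentiable_inner
          differentiable_const differentiableI_vector)
    then show ?thesis by (auto simp: vector_derivative_works)
  qed
  then obtain \<nu>' where \<nu>': "\<And>w. (\<nu> w has_vector_derivative \<nu>' w) (at s within S)" by metis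
  have \<nu>a: "\<nu> w t \<bullet> a t = 0" for w t by (simp add: \<nu>_def perp_inner)
  have \<nu>'a: "\<nu>' w \<bullet> a s = - (\<nu> w s \<bullet> a')" for w
  proof -
    have "((\<lambda>t. \<nu> w t \<bullet> a t) has_vector_derivative (\<nu> w s \<bullet> a' + \<nu>' w \<bullet> a s)) (at s within S)"
      using has_real_derivative_inner[OF \<nu>' der(1)] has_real_derivative_iff_has_vector_derivative by blast
    then have "((\<lambda>t. 0) has_vector_derivative (\<nu> w s \<bullet> a' + \<nu>' w \<bullet> a s)) (at s within S)"
      by (simp add: \<nu>a)
    then have "\<nu> w s \<bullet> a' + \<nu>' w \<bullet> a s = 0"
      using vector_derivative_unique_within[OF S _ has_vector_derivative_const] by blast
    then show ?thesis by simp
  qed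
  have "\<nu> w s \<bullet> d' + \<nu>' w \<bullet> d s = P w" for w
    using \<nu>'a[of w] by (simp add: P_def d \<nu>_def inner_diff_right)
  then have p12: "((\<lambda>t. \<nu> w t \<bullet> d t) has_real_derivative P w) (at s within S)" for w
    using has_real_derivative_inner[OF \<nu>' der(4), of w] by simp
  note p11 = has_real_derivative_inner[OF \<nu>' der(3)] and p22 = has_real_derivative_inner[OF \<nu>' der(5)]
  have g12: "((\<lambda>t. a t \<bullet> b t) has_real_derivative 0) (at s within S)"
    using has_real_derivative_inner[OF der(1,2)] orth(2) by simp
  note g11 = has_real_derivative_inner[OF der(1,1)] and g22 = has_real_derivative_inner[OF der(2,2)]
  have 0: "\<nu> w s \<bullet> d s = 0" for w by (simp add: d \<nu>a)
  show ?thesis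
    unfolding ricci_form_def
    by (rule derivative_eq_intros p11 p12 p22 g11 g12 g22 refl)+ (simp add: 0 orth(1) mult.commute)
qed

lemma deriv_nonzero_imp_locally_nonzero:
  fixes f :: "real \<Rightarrow> real"
  assumes "(f has_real_derivative k) (at 0 within {0..<T})" "f 0 = 0" "k \<noteq> 0" "T > 0"
  shows "\<exists>\<delta>\<in>{0<..<T}. \<forall>t\<in>{0<..<\<delta>}. f t \<noteq> 0"
proof -
  have "((\<lambda>t. (f t - f 0) / (t - 0)) \<longlongrightarrow> k) (at 0 within {0..<T})"
    using assms(1) has_field_derivative_iff by blast
  then have "\<forall>\<^sub>F t in at 0 within {0..<T}. (f t - f 0) / (t - 0) \<noteq> 0"
    using assms(3) tendsto_imp_eventually_ne by blast
  then obtain r where r: "r > 0" "\<And>t. t \<in> {0..<T} \<Longrightarrow> t \<noteq> 0 \<Longrightarrow> dist t 0 < r \<Longrightarrow> f t \<noteq> 0"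
    unfolding eventually_at using assms(2) by auto
  show ?thesis
    \<comment> \<open>Halving \<open>T\<close> keeps \<delta> strictly below
      \<open>T\<close>.\<close>
    by (rule bexI[of _ "min r (T / 2)"]) (use r assms(4) in auto)
qed

context immersed_surface
begin

lemma mean_curvature_normal: "mean_curvature F x \<bullet> pd i F x = 0"
proof -
  have n: "normal_part F x w \<bullet> pd i F x = 0" for w
    using normal_part_normal[of x w] exhaust_2[of i] by (auto simp: normal_space_iff)
  show ?thesis
    unfolding mean_curvature_def second_fundamental_form_def by (simp add: inner_sum_left n)
qed

end

text \<open>Reduces the loss of flatness to one number at one point: by \<open>nz\<close> the
  function \<open>K\<close> has nonzero time derivative at 0, while it vanishes at 0 and at every
  time with flat normal bundle.\<close>

lemma not_flat_short_time:
  fixes F :: "real \<Rightarrow> real^2 \<Rightarrow> real^'n"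
  assumes flow: "mean_curvature_flow F0 T F"
    and g12: "pd 1 F0 x \<bullet> pd 2 F0 x = 0" and F12: "pd 2 (pd 1 F0) x = l *\<^sub>R pd 1 F0 x"
  defines "H \<equiv> mean_curvature F0"
  defines "\<nu> \<equiv> perp (pd 1 F0 x) (pd 2 F0 x)"
    and "P \<equiv> \<lambda>w. perp (pd 1 F0 x) (pd 2 F0 x) w \<bullet> (pd 2 (pd 1 H) x - l *\<^sub>R pd 1 H x)"
  assumes nz: "(pd 2 F0 x \<bullet> pd 2 F0 x) * (P w * (\<nu> w' \<bullet> pd 1 (pd 1 F0) x) - (\<nu> w \<bullet> pd 1 (pd 1 F0) x) * P w')
    + (pd 1 F0 x \<bullet> pd 1 F0 x) * ((\<nu> w \<bullet> pd 2 (pd 2 F0) x) * P w' - P w * (\<nu> w' \<bullet> pd 2 (pd 2 F0) x)) \<noteq> 0"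
  shows "\<exists>\<delta>\<in>{0<..<T}. \<forall>t\<in>{0<..<\<delta>}. \<not> flat_normal_bundle (F t)"
proof -
  have T: "T > 0" and F0: "F 0 = F0" and imm: "\<And>t. t \<in> {0..<T} \<Longrightarrow> torus_immersion (F t)"
    using flow by (auto simp: mean_curvature_flow_def)
  interpret F0: immersed_surface F0 by unfold_locales (use imm[of 0] F0 T in auto)
  note der = mean_curvature_flow_derivatives[OF flow, folded H_def]
  \<comment> \<open>Differentiates the orthogonality of \<open>H\<close> to the coordinate
    fields.\<close>
  have "pd i H x \<bullet> pd j F0 x = - (H x \<bullet> pd i (pd j F0) x)" for i j
  proof -
    have "dirD (axis i 1) (\<lambda>x. H x \<bullet> pd j F0 x) x = 0"
      unfolding H_def F0.mean_curvature_normal by (simp add: dirD_def)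
    then show ?thesis by (simp add: dirD_inner der F0.differentiable)
  qed
  \<comment> \<open>The initial velocity of the off-diagonal metric entry is -2 times the inner
    product of \<open>H\<close> with the mixed derivative, which vanishes because that derivative is
    tangent.\<close>
  then have g12': "pd 1 F0 x \<bullet> pd 2 H x + pd 1 H x \<bullet> pd 2 F0 x = 0"
    using F0.mean_curvature_normal[of x 1]
    by (simp add: inner_commute[of "pd 1 F0 x" "pd 2 H x"] F0.pd_pd_commute[of 1 2] F12 flip: H_def)
  define K where "K t = ricci_form (pd 1 (F t) x) (pd 2 (F t) x) (pd 1 (pd 1 (F t)) x) (pd 2 (pd 1 (F t)) x)
    (pd 2 (pd 2 (F t)) x) (perp (pd 1 (F t) x) (pd 2 (F t) x) w) (perp (pd 1 (F t) x) (pd 2 (F t) x) w')" for t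
  note bot = at_0_within_half_open[OF T]
  note d1 = der(3)[where x = x and v = "axis 1 1"] and d2 = der(3)[where x = x and v = "axis 2 1"]
  note dd = der(4)[where x = x]
  note K' = ricci_form_has_derivative[OF d1 d2 dd[where u = "axis 1 1" and v = "axis 1 1"]
      dd[where u = "axis 2 1" and v = "axis 1 1"] dd[where u = "axis 2 1" and v = "axis 2 1"] bot,
      where w = w and w' = w', unfolded F0, OF g12 g12' F12, folded K_def[abs_def]]
  have "K 0 = 0"
    by (simp add: K_def F0 ricci_form_def g12 F12 perp_inner)
  from deriv_nonzero_imp_locally_nonzero[OF K' this nz[unfolded P_def \<nu>_def] T]
  obtain \<delta> where \<delta>: "\<delta> \<in> {0<..<T}" "\<And>t. t \<in> {0<..<\<delta>} \<Longrightarrow> K t \<noteq> 0" by blast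
  have "\<not> flat_normal_bundle (F t)" if "t \<in> {0<..<\<delta>}" for t
  proof
    assume "flat_normal_bundle (F t)"
    interpret Ft: immersed_surface "F t" by unfold_locales (use imm that \<delta>(1) in auto)
    show False
      using Ft.ricci_form_eq_0_if_flat[OF \<open>flat_normal_bundle (F t)\<close>, of x w w'] \<delta>(2)[OF that]
      by (simp add: K_def Ft.pd_pd_commute[of 2 1])
  qed
  with \<delta>(1) show ?thesis by blast
qed

section \<open>The initial torus\<close>

lemma matrix_inv_unique:
  fixes A B :: "real^'n^'n"
  assumes "A ** B = mat 1" "B ** A = mat 1"
  shows "matrix_inv A = B"
proof -
  have inv: "A ** matrix_inv A = mat 1"
    unfolding matrix_inv_def using assms by (rule_tac someI2[of _ B]) auto
  have "matrix_inv A = (B ** A) ** matrix_inv A" using assms(2) by simp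
  also have "\<dots> = B" by (simp add: matrix_mul_assoc[symmetric] inv)
  finally show ?thesis .
qed

context immersed_surface
begin

text \<open>The inverse metric is diagonal, so only the two pure second derivatives enter the
  trace.\<close>

lemma mean_curvature_principal_coordinates:
  assumes g12: "pd 1 F x \<bullet> pd 2 F x = 0" and F12: "pd 1 (pd 2 F) x = l *\<^sub>R pd 1 F x"
  shows "mean_curvature F x = normal_part F x
    ((1 / (pd 1 F x \<bullet> pd 1 F x)) *\<^sub>R pd 1 (pd 1 F) x + (1 / (pd 2 F x \<bullet> pd 2 F x)) *\<^sub>R pd 2 (pd 2 F) x)"
proof -
  let ?a = "pd 1 F x" and ?b = "pd 2 F x"
  have ne: "?a \<bullet> ?a \<noteq> 0" "?b \<bullet> ?b \<noteq> 0"
    using gram_pos[of x] by (auto simp: gram_def)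
  have g: "induced_metric F x = (\<chi> i j. if i = j then (if i = 1 then ?a \<bullet> ?a else ?b \<bullet> ?b) else 0)"
    by (simp add: induced_metric_def dirD_def[symmetric] vec_eq_iff forall_2 g12 inner_commute[of ?b ?a])
  have inv: "matrix_inv (induced_metric F x) =
      (\<chi> i j. if i = j then (if i = 1 then 1 / (?a \<bullet> ?a) else 1 / (?b \<bullet> ?b)) else 0)"
    unfolding g by (rule matrix_inv_unique)
      (use ne in \<open>auto simp: vec_eq_iff matrix_matrix_mult_def mat_def sum_2 forall_2\<close>)
  have A: "second_fundamental_form F (\<lambda>_. axis i 1) (\<lambda>_. axis j 1) x = normal_part F x (pd i (pd j F) x)" for i j
    by (simp add: second_fundamental_form_def dir_deriv_def[abs_def] dirD_def[abs_def])
  show ?thesis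
    unfolding mean_curvature_def inv A
    by (simp add: sum_2 linear_add[OF linear_normal_part] linear_scale[OF linear_normal_part])
qed

end

section \<open>Embeddings of the torus by compactness\<close>

lemma compact_torus: "compact torus"
proof -
  have "closed (torus :: (complex^'m) set)"
    unfolding torus_def by (intro closed_Collect_all closed_Collect_eq continuous_intros)
  moreover have "norm z \<le> real CARD('m)" if "z \<in> torus" for z :: "complex^'m"
    using that L2_set_le_sum[of UNIV "\<lambda>i. norm (z $ i)"] by (simp add: torus_def norm_vec_def)
  ultimately show ?thesis
    unfolding compact_eq_bounded_closed bounded_iff by blast
qed

text \<open>A continuous map from a compact space to a Hausdorff space is closed, so injectivity
  suffices.\<close>

lemma embedding_map_torus:
  fixes f :: "complex^'m \<Rightarrow> real^'n"
  assumes "continuous_on torus f" "inj_on f torus"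
  shows "embedding_map (top_of_set torus) euclidean f"
proof (rule injective_closed_imp_embedding_map)
  show c: "continuous_map (top_of_set torus) euclidean f" using assms(1) by simp
  show "closed_map (top_of_set torus) euclidean f"
    by (rule continuous_imp_closed_map_gen[OF _ _ c])
      (simp_all add: compact_space_subtopology compact_torus Hausdorff_imp_kc_space)
qed (use assms in simp)

lemma periodic_torus_proj: "periodic (f \<circ> torus_proj)"
proof -
  have "cis (2 * pi * (a + n)) = cis (2 * pi * a)" if "n \<in> \<int>" for a n
    using that by (simp add: distrib_left cis_mult[symmetric] cis_multiple_2pi)
  then show ?thesis by (simp add: periodic_def torus_proj_def)
qed

text \<open>A sum of scaled basis vectors, so that the rules for sums and multiples give continuity,
  smoothness and derivatives.\<close>

definition vec4 :: "real \<Rightarrow> real \<Rightarrow> real \<Rightarrow> real \<Rightarrow> real^4" where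
  "vec4 a b c d = a *\<^sub>R axis 1 1 + b *\<^sub>R axis 2 1 + c *\<^sub>R axis 3 1 + d *\<^sub>R axis 4 1"

lemma vec4_nth [simp]: "vec4 a b c d $ 1 = a" "vec4 a b c d $ 2 = b" "vec4 a b c d $ 3 = c" "vec4 a b c d $ 4 = d"
  by (simp_all add: vec4_def axis_def)

lemma vec4_eq_iff: "vec4 a b c d = vec4 a' b' c' d' \<longleftrightarrow> a = a' \<and> b = b' \<and> c = c' \<and> d = d'"
  by (simp add: vec_eq_iff forall_4)

lemma vec4_simps:
  "vec4 a b c d \<bullet> vec4 a' b' c' d' = a * a' + b * b' + c * c' + d * d'"
  "k *\<^sub>R vec4 a b c d = vec4 (k * a) (k * b) (k * c) (k * d)"
  "vec4 a b c d + vec4 a' b' c' d' = vec4 (a + a') (b + b') (c + c') (d + d')"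
  "vec4 a b c d - vec4 a' b' c' d' = vec4 (a - a') (b - b') (c - c') (d - d')"
  by (simp_all add: vec_eq_iff forall_4 inner_vec_def sum_4)

lemma pd_vec4:
  fixes a b c d :: "real^2 \<Rightarrow> real"
  assumes "(a has_derivative (\<lambda>v. v $ 1 * a1 + v $ 2 * a2)) (at x)" "(b has_derivative (\<lambda>v. v $ 1 * b1 + v $ 2 * b2)) (at x)"
    "(c has_derivative (\<lambda>v. v $ 1 * c1 + v $ 2 * c2)) (at x)" "(d has_derivative (\<lambda>v. v $ 1 * d1 + v $ 2 * d2)) (at x)"
  shows "pd 1 (\<lambda>x. vec4 (a x) (b x) (c x) (d x)) x = vec4 a1 b1 c1 d1"
    "pd 2 (\<lambda>x. vec4 (a x) (b x) (c x) (d x)) x = vec4 a2 b2 c2 d2"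
proof -
  have "((\<lambda>x. vec4 (a x) (b x) (c x) (d x)) has_derivative (\<lambda>v. vec4 (v $ 1 * a1 + v $ 2 * a2)
      (v $ 1 * b1 + v $ 2 * b2) (v $ 1 * c1 + v $ 2 * c2) (v $ 1 * d1 + v $ 2 * d2))) (at x)"
    unfolding vec4_def by (intro has_derivative_add has_derivative_scaleR_left assms)
  from dirD_eqI[OF this] show "pd 1 (\<lambda>x. vec4 (a x) (b x) (c x) (d x)) x = vec4 a1 b1 c1 d1"
    "pd 2 (\<lambda>x. vec4 (a x) (b x) (c x) (d x)) x = vec4 a2 b2 c2 d2"
    by (simp_all add: axis_def)
qed

text \<open>The angles \<theta> and \<phi> are \<open>2 * pi\<close> times the coordinates, so
  integer translations are periods and each coordinate derivative carries a factor
  \<open>2 * pi\<close>.\<close>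

abbreviation co :: "'m \<Rightarrow> real^'m \<Rightarrow> real" where "co i x \<equiv> cos (2 * pi * x $ i)"
abbreviation si :: "'m \<Rightarrow> real^'m \<Rightarrow> real" where "si i x \<equiv> sin (2 * pi * x $ i)"

lemma has_derivative_co_si:
  "(co i has_derivative (\<lambda>v. v $ i * (- (2 * pi) * si i x))) (at x)"
  "(si i has_derivative (\<lambda>v. v $ i * (2 * pi * co i x))) (at x)"
  by (auto intro!: derivative_eq_intros bounded_linear.has_derivative[OF bounded_linear_vec_nth] simp: fun_eq_iff)

text \<open>The induction treats both functions together, since the derivative of each is a multiple
  of the other.\<close>

lemma Cinf_on_co_si: "Cinf_on UNIV (co i)" "Cinf_on UNIV (si i)"
proof -
  have "Ck_on k UNIV (co i) \<and> Ck_on k UNIV (si i)" for k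
  proof (induction k)
    case 0
    show ?case by (auto intro!: continuous_intros)
  next
    case (Suc k)
    have "dirD v (co i) = (\<lambda>x. (- (2 * pi) * v $ i) * si i x)" "dirD v (si i) = (\<lambda>x. (2 * pi * v $ i) * co i x)" for v
      by (auto simp: fun_eq_iff dirD_eqI[OF has_derivative_co_si(1)] dirD_eqI[OF has_derivative_co_si(2)])
    then show ?case
      using Suc has_derivative_co_si Ck_on_prod[OF bounded_bilinear_mult open_UNIV Ck_on_const]
      unfolding Ck_on_Suc differentiable_def by metis
  qed
  then show "Cinf_on UNIV (co i)" "Cinf_on UNIV (si i)" by (simp_all add: Cinf_on_def)
qed

text \<open>In angles \<open>\<theta>\<close>, \<open>\<phi>\<close> the surface is
  \<open>((5 + sin \<phi>) n(\<theta>) + (sin\<^sup>3 \<theta>, cos\<^sup>3 \<theta>), cos \<phi>, sin \<phi>)\<close> with \<open>n(\<theta>) = (cos \<theta>, sin \<theta>)\<close>: over each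
  \<open>\<phi>\<close> lies a convex curve with normal \<open>n\<close> and radius of curvature \<open>\<rho> = 5 + sin \<phi> - 3 sin \<theta> cos \<theta>\<close>.\<close>

definition torus_map :: "complex^2 \<Rightarrow> real^4" where
  "torus_map z = vec4 ((5 + Im (z $ 2)) * Re (z $ 1) + Im (z $ 1) ^ 3)
     ((5 + Im (z $ 2)) * Im (z $ 1) + Re (z $ 1) ^ 3) (Re (z $ 2)) (Im (z $ 2))"

definition initial_torus :: "real^2 \<Rightarrow> real^4" where
  "initial_torus = torus_map \<circ> torus_proj"

lemma initial_torus_eq: "initial_torus = (\<lambda>x. vec4 ((5 + si 2 x) * co 1 x + si 1 x ^ 3) ((5 + si 2 x) * si 1 x + co 1 x ^ 3) (co 2 x) (si 2 x))"
  by (simp add: initial_torus_def torus_map_def torus_proj_def fun_eq_iff)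

text \<open>For injectivity of the torus map, any Lipschitz constant below 4 would do.\<close>

lemma cube_diff_le:
  fixes x y :: real
  assumes "\<bar>x\<bar> \<le> 1" "\<bar>y\<bar> \<le> 1"
  shows "\<bar>x ^ 3 - y ^ 3\<bar> \<le> 3 * \<bar>x - y\<bar>"
proof -
  have "x ^ 3 - y ^ 3 = (x * x + x * y + y * y) * (x - y)" by (simp add: power3_eq_cube algebra_simps)
  moreover have "\<bar>x * x + x * y + y * y\<bar> \<le> 3"
  proof -
    have "\<bar>x * x\<bar> \<le> 1" "\<bar>x * y\<bar> \<le> 1" "\<bar>y * y\<bar> \<le> 1"
      using assms by (simp_all only: abs_mult mult_le_one abs_ge_zero)
    then show ?thesis by linarith
  qed
  ultimately show ?thesis by (simp add: abs_mult mult_right_mono)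
qed

text \<open>The last two coordinates determine \<open>z $ 2\<close>. In the first two, the cubes
  have Lipschitz constant 3 against a factor \<open>c\<close> of at least 4, so \<open>X\<close> and
  \<open>Y\<close> each have at most 3/4 of the size of the other and both vanish.\<close>

lemma inj_on_torus_map: "inj_on torus_map torus"
proof (rule inj_onI)
  fix z w :: "complex^2"
  assume z: "z \<in> torus" and w: "w \<in> torus" and eq: "torus_map z = torus_map w"
  have le: "\<bar>Re (v $ i)\<bar> \<le> 1" "\<bar>Im (v $ i)\<bar> \<le> 1" if "v \<in> torus" for v :: "complex^2" and i
    using that abs_Re_le_cmod[of "v $ i"] abs_Im_le_cmod[of "v $ i"] by (simp_all add: torus_def)
  define c where "c = 5 + Im (w $ 2)"
  have c: "c \<ge> 4" using le(2)[OF w, of 2] by (simp add: c_def abs_le_iff)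
  have 2: "z $ 2 = w $ 2" using eq by (simp add: torus_map_def vec4_eq_iff complex_eq_iff)
  define X where "X = Re (z $ 1) - Re (w $ 1)"
  define Y where "Y = Im (z $ 1) - Im (w $ 1)"
  have "c * X = - (Im (z $ 1) ^ 3 - Im (w $ 1) ^ 3)" "c * Y = - (Re (z $ 1) ^ 3 - Re (w $ 1) ^ 3)"
    using eq unfolding torus_map_def vec4_eq_iff 2 c_def X_def Y_def by (simp_all add: algebra_simps)
  then have "\<bar>c * X\<bar> \<le> 3 * \<bar>Y\<bar>" "\<bar>c * Y\<bar> \<le> 3 * \<bar>X\<bar>"
    using cube_diff_le le z w unfolding X_def Y_def by (metis abs_minus_cancel)+
  moreover have "4 * \<bar>X\<bar> \<le> \<bar>c * X\<bar>" "4 * \<bar>Y\<bar> \<le> \<bar>c * Y\<bar>"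
    using c by (simp_all add: abs_mult mult_right_mono)
  ultimately have "X = 0" "Y = 0" by linarith+
  with 2 show "z = w" by (simp add: X_def Y_def vec_eq_iff forall_2 complex_eq_iff)
qed

definition rad :: "real^2 \<Rightarrow> real" where
  "rad x = 5 + si 2 x - 3 * si 1 x * co 1 x"

lemma rad_pos: "rad x > 0"
proof -
  have "(si 1 x - co 1 x)\<^sup>2 \<ge> 0" by simp
  then have "2 * (si 1 x * co 1 x) \<le> (si 1 x)\<^sup>2 + (co 1 x)\<^sup>2" by (simp add: power2_diff)
  then have "2 * (si 1 x * co 1 x) \<le> 1" by simp
  moreover have "si 2 x \<ge> -1" by simp
  ultimately show ?thesis unfolding rad_def by linarith
qed

text \<open>The derivative of \<open>rad\<close> in the angle \<theta>, hence without the factor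
  \<open>2 * pi\<close> of a coordinate derivative.\<close>

definition rad' :: "real^2 \<Rightarrow> real" where
  "rad' x = - 3 * (co 1 x * co 1 x - si 1 x * si 1 x)"

lemmas has_derivative_trig_poly =
  has_derivative_const has_derivative_co_si has_derivative_add has_derivative_diff has_derivative_mult
  has_derivative_power

lemma has_derivative_rad:
  "(rad has_derivative (\<lambda>v. v $ 1 * (2 * pi * rad' x) + v $ 2 * (2 * pi * co 2 x))) (at x)"
  unfolding rad_def
  by (rule has_derivative_eq_rhs, (rule has_derivative_trig_poly)+)
    (simp add: rad'_def fun_eq_iff algebra_simps)

text \<open>The \<theta>-derivative of the cubic term is
  \<open>- 3 sin \<theta> cos \<theta>\<close> times the unit vector
  \<open>(- sin \<theta>, cos \<theta>)\<close>, so it merges with that of the circle into the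
  factor \<open>rad\<close>.\<close>

lemma initial_torus_pd:
  "pd 1 initial_torus = (\<lambda>x. vec4 ((- 2 * pi) * (rad x * si 1 x)) ((2 * pi) * (rad x * co 1 x)) 0 0)"
  "pd 2 initial_torus = (\<lambda>x. vec4 ((2 * pi) * (co 2 x * co 1 x)) ((2 * pi) * (co 2 x * si 1 x))
     ((- 2 * pi) * si 2 x) ((2 * pi) * co 2 x))"
proof -
  have 1: "((\<lambda>x. (5 + si 2 x) * co 1 x + si 1 x ^ 3) has_derivative
      (\<lambda>v. v $ 1 * ((- 2 * pi) * (rad x * si 1 x)) + v $ 2 * ((2 * pi) * (co 2 x * co 1 x)))) (at x)" for x :: "real^2"
    by (rule has_derivative_eq_rhs, (rule has_derivative_trig_poly)+)
      (simp add: rad_def fun_eq_iff power2_eq_square algebra_simps)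
  have 2: "((\<lambda>x. (5 + si 2 x) * si 1 x + co 1 x ^ 3) has_derivative
      (\<lambda>v. v $ 1 * ((2 * pi) * (rad x * co 1 x)) + v $ 2 * ((2 * pi) * (co 2 x * si 1 x)))) (at x)" for x :: "real^2"
    by (rule has_derivative_eq_rhs, (rule has_derivative_trig_poly)+)
      (simp add: rad_def fun_eq_iff power2_eq_square algebra_simps)
  have 3: "(co 2 has_derivative (\<lambda>v. v $ 1 * 0 + v $ 2 * ((- 2 * pi) * si 2 x))) (at x)" for x :: "real^2"
    by (rule has_derivative_eq_rhs, rule has_derivative_trig_poly) simp
  have 4: "(si 2 has_derivative (\<lambda>v. v $ 1 * 0 + v $ 2 * ((2 * pi) * co 2 x))) (at x)" for x :: "real^2"
    by (rule has_derivative_eq_rhs, rule has_derivative_trig_poly) simp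
  show "pd 1 initial_torus = (\<lambda>x. vec4 ((- 2 * pi) * (rad x * si 1 x)) ((2 * pi) * (rad x * co 1 x)) 0 0)"
    "pd 2 initial_torus = (\<lambda>x. vec4 ((2 * pi) * (co 2 x * co 1 x)) ((2 * pi) * (co 2 x * si 1 x))
      ((- 2 * pi) * si 2 x) ((2 * pi) * co 2 x))"
    unfolding initial_torus_eq by (intro ext pd_vec4[OF 1 2 3 4])+
qed

lemma initial_torus_pd_pd:
  "pd 1 (pd 1 initial_torus) = (\<lambda>x. (4 * pi\<^sup>2) *\<^sub>R
     vec4 (- (rad' x * si 1 x) - rad x * co 1 x) (rad' x * co 1 x - rad x * si 1 x) 0 0)"
  "pd 2 (pd 1 initial_torus) = (\<lambda>x. (4 * pi\<^sup>2) *\<^sub>R vec4 (- (co 2 x * si 1 x)) (co 2 x * co 1 x) 0 0)"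
  "pd 2 (pd 2 initial_torus) = (\<lambda>x. (4 * pi\<^sup>2) *\<^sub>R
     vec4 (- (si 2 x * co 1 x)) (- (si 2 x * si 1 x)) (- co 2 x) (- si 2 x))"
proof -
  note R = has_derivative_rad has_derivative_trig_poly
  have 1: "((\<lambda>x. (- 2 * pi) * (rad x * si 1 x)) has_derivative
      (\<lambda>v. v $ 1 * (4 * pi\<^sup>2 * (- (rad' x * si 1 x) - rad x * co 1 x)) + v $ 2 * (4 * pi\<^sup>2 * (- (co 2 x * si 1 x))))) (at x)"
    for x by (rule has_derivative_eq_rhs, (rule R)+) (simp add: fun_eq_iff power2_eq_square algebra_simps)
  have 2: "((\<lambda>x. (2 * pi) * (rad x * co 1 x)) has_derivative
      (\<lambda>v. v $ 1 * (4 * pi\<^sup>2 * (rad' x * co 1 x - rad x * si 1 x)) + v $ 2 * (4 * pi\<^sup>2 * (co 2 x * co 1 x)))) (at x)"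
    for x by (rule has_derivative_eq_rhs, (rule R)+) (simp add: fun_eq_iff power2_eq_square algebra_simps)
  have 0: "((\<lambda>x. 0) has_derivative (\<lambda>v. v $ 1 * (4 * pi\<^sup>2 * 0) + v $ 2 * (4 * pi\<^sup>2 * 0))) (at x)" for x :: "real^2"
    by simp
  show "pd 1 (pd 1 initial_torus) = (\<lambda>x. (4 * pi\<^sup>2) *\<^sub>R
      vec4 (- (rad' x * si 1 x) - rad x * co 1 x) (rad' x * co 1 x - rad x * si 1 x) 0 0)"
    "pd 2 (pd 1 initial_torus) = (\<lambda>x. (4 * pi\<^sup>2) *\<^sub>R vec4 (- (co 2 x * si 1 x)) (co 2 x * co 1 x) 0 0)"
    unfolding initial_torus_pd vec4_simps by (intro ext pd_vec4[OF 1 2 0 0])+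
  have 1: "((\<lambda>x. (2 * pi) * (co 2 x * co 1 x)) has_derivative
      (\<lambda>v. v $ 1 * (4 * pi\<^sup>2 * (- (co 2 x * si 1 x))) + v $ 2 * (4 * pi\<^sup>2 * (- (si 2 x * co 1 x))))) (at x)" for x :: "real^2"
    by (rule has_derivative_eq_rhs, (rule R)+) (simp add: fun_eq_iff power2_eq_square algebra_simps)
  have 2: "((\<lambda>x. (2 * pi) * (co 2 x * si 1 x)) has_derivative
      (\<lambda>v. v $ 1 * (4 * pi\<^sup>2 * (co 2 x * co 1 x)) + v $ 2 * (4 * pi\<^sup>2 * (- (si 2 x * si 1 x))))) (at x)" for x :: "real^2"
    by (rule has_derivative_eq_rhs, (rule R)+) (simp add: fun_eq_iff power2_eq_square algebra_simps)
  have 3: "((\<lambda>x. (- 2 * pi) * si 2 x) has_derivative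
      (\<lambda>v. v $ 1 * 0 + v $ 2 * (4 * pi\<^sup>2 * (- co 2 x)))) (at x)" for x :: "real^2"
    by (rule has_derivative_eq_rhs, (rule R)+) (simp add: fun_eq_iff power2_eq_square algebra_simps)
  have 4: "((\<lambda>x. (2 * pi) * co 2 x) has_derivative
      (\<lambda>v. v $ 1 * 0 + v $ 2 * (4 * pi\<^sup>2 * (- si 2 x)))) (at x)" for x :: "real^2"
    by (rule has_derivative_eq_rhs, (rule R)+) (simp add: fun_eq_iff power2_eq_square algebra_simps)
  show "pd 2 (pd 2 initial_torus) = (\<lambda>x. (4 * pi\<^sup>2) *\<^sub>R
      vec4 (- (si 2 x * co 1 x)) (- (si 2 x * si 1 x)) (- co 2 x) (- si 2 x))"
    unfolding initial_torus_pd vec4_simps by (intro ext pd_vec4[OF 1 2 3 4])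
qed

section \<open>Metric, embeddedness and flatness of the initial torus\<close>

lemma co_si_sq: "co i x * co i x + si i x * si i x = 1"
  using sin_cos_squared_add3 by blast

lemma initial_torus_metric:
  "pd 1 initial_torus x \<bullet> pd 1 initial_torus x = 4 * pi\<^sup>2 * (rad x)\<^sup>2"
  "pd 2 initial_torus x \<bullet> pd 2 initial_torus x = 4 * pi\<^sup>2 * (1 + (co 2 x)\<^sup>2)"
  "pd 1 initial_torus x \<bullet> pd 2 initial_torus x = 0"
proof -
  have "pd 1 initial_torus x \<bullet> pd 1 initial_torus x = 4 * pi\<^sup>2 * (rad x)\<^sup>2 * (co 1 x * co 1 x + si 1 x * si 1 x)"
    by (simp add: initial_torus_pd vec4_simps power2_eq_square algebra_simps del: sin_cos_squared_add3)
  then show "pd 1 initial_torus x \<bullet> pd 1 initial_torus x = 4 * pi\<^sup>2 * (rad x)\<^sup>2" by (simp add: co_si_sq)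
  have "pd 2 initial_torus x \<bullet> pd 2 initial_torus x = 4 * pi\<^sup>2 * (co 2 x * co 2 x * (co 1 x * co 1 x + si 1 x * si 1 x)
      + (co 2 x * co 2 x + si 2 x * si 2 x))"
    by (simp add: initial_torus_pd vec4_simps power2_eq_square algebra_simps del: sin_cos_squared_add3)
  then show "pd 2 initial_torus x \<bullet> pd 2 initial_torus x = 4 * pi\<^sup>2 * (1 + (co 2 x)\<^sup>2)"
    by (simp add: co_si_sq power2_eq_square algebra_simps)
  show "pd 1 initial_torus x \<bullet> pd 2 initial_torus x = 0" by (simp add: initial_torus_pd vec4_simps algebra_simps)
qed

lemma initial_torus_smooth: "Cinf_on UNIV initial_torus"
  unfolding initial_torus_eq vec4_def power3_eq_cube by (intro Cinf_on_intros Cinf_on_co_si open_UNIV)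

lemma initial_torus_immersion: "torus_immersion initial_torus"
proof -
  have d: "initial_torus differentiable (at x)" for x using Cinf_on_differentiable[OF initial_torus_smooth] by simp
  have "inj (frechet_derivative initial_torus (at x))" for x
    unfolding linear_injective_0[OF linear_frechet_derivative[OF d]]
  proof (intro allI impI)
    fix v assume "frechet_derivative initial_torus (at x) v = 0"
    then have 0: "v $ 1 *\<^sub>R pd 1 initial_torus x + v $ 2 *\<^sub>R pd 2 initial_torus x = 0"
      using dirD_vec2[OF d, of v x] by (simp add: dirD_def)
    have "v $ 1 * (pd 1 initial_torus x \<bullet> pd 1 initial_torus x) = 0"
      using arg_cong[OF 0, of "\<lambda>u. u \<bullet> pd 1 initial_torus x"]
      by (simp add: inner_add_left initial_torus_metric(3) inner_commute[of "pd 2 initial_torus x"])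
    then have 1: "v $ 1 = 0" using rad_pos[of x] by (simp add: initial_torus_metric)
    have "v $ 2 * (pd 2 initial_torus x \<bullet> pd 2 initial_torus x) = 0"
      using arg_cong[OF 0, of "\<lambda>u. u \<bullet> pd 2 initial_torus x"] by (simp add: inner_add_left initial_torus_metric(3))
    moreover have "1 + (co 2 x)\<^sup>2 \<noteq> 0" using zero_le_power2[of "co 2 x"] by linarith
    ultimately have "v $ 2 = 0" by (simp add: initial_torus_metric)
    with 1 show "v = 0" by (simp add: vec_eq_iff forall_2)
  qed
  moreover have "periodic initial_torus" unfolding initial_torus_def by (rule periodic_torus_proj)
  ultimately show ?thesis using initial_torus_smooth by (simp add: torus_immersion_def torus_smooth_def)
qed

lemma initial_torus_embedding: "torus_embedding initial_torus"
proof -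
  have "continuous_on torus torus_map"
    unfolding torus_map_def vec4_def by (intro continuous_intros)
  then have "embedding_map (top_of_set torus) euclidean torus_map"
    using embedding_map_torus inj_on_torus_map by blast
  then show ?thesis using initial_torus_immersion unfolding torus_embedding_def initial_torus_def by blast
qed

interpretation initial_torus: immersed_surface initial_torus
  by unfold_locales (rule initial_torus_immersion)

text \<open>The direction of the first coordinate field depends on \<theta> alone, so only its
  factor \<open>rad\<close> is differentiated; the coefficient is the logarithmic derivative of
  \<open>rad\<close>.\<close>

lemma initial_torus_pd_2_1: "pd 2 (pd 1 initial_torus) x = (2 * pi * co 2 x / rad x) *\<^sub>R pd 1 initial_torus x"
  unfolding initial_torus_pd_pd using rad_pos[of x] by (simp add: initial_torus_pd vec4_simps vec4_eq_iff power2_eq_square)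

lemma initial_torus_pd_1_2: "pd 1 (pd 2 initial_torus) x = (2 * pi * co 2 x / rad x) *\<^sub>R pd 1 initial_torus x"
  using initial_torus_pd_2_1 initial_torus.pd_pd_commute by metis

lemma initial_torus_flat: "flat_normal_bundle initial_torus"
  by (rule initial_torus.flat_if_principal_coordinates[OF initial_torus_metric(3) initial_torus_pd_1_2])

text \<open>With \<open>e = (0, 0, cos \<phi>, sin \<phi>)\<close>, the mean curvature vector is
  \<open>curv (n - cos \<phi> \<partial>\<^sub>\<phi>e) - ifac e\<close>; \<open>1 / ifac\<close> is the squared length of \<open>\<partial>\<^sub>\<phi>F\<close>.\<close>

definition ifac :: "real^2 \<Rightarrow> real" where "ifac x = 1 / (1 + (co 2 x)\<^sup>2)"

definition curv :: "real^2 \<Rightarrow> real" where "curv x = - (ifac x * (1 / rad x + ifac x * si 2 x))"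

text \<open>The candidate is verified by uniqueness of the normal part: it is normal and differs by
  a tangent vector from the metric trace \<open>?W\<close> of the second derivatives.\<close>

lemma mean_curvature_initial_torus:
  "mean_curvature initial_torus x = vec4 (curv x * co 1 x) (curv x * si 1 x)
     (curv x * co 2 x * si 2 x - ifac x * co 2 x) (- (curv x * (co 2 x)\<^sup>2) - ifac x * si 2 x)" (is "_ = ?H")
proof -
  have q: "1 - ifac x = ifac x * (co 2 x)\<^sup>2"
    using zero_le_power2[of "co 2 x"] by (simp add: ifac_def field_simps add_nonneg_eq_0_iff)
  have r: "rad x \<noteq> 0" using rad_pos[of x] by simp
  define k where "k = 1 / rad x + ifac x * si 2 x"
  let ?W = "(1 / (pd 1 initial_torus x \<bullet> pd 1 initial_torus x)) *\<^sub>R pd 1 (pd 1 initial_torus) x + (1 / (pd 2 initial_torus x \<bullet> pd 2 initial_torus x)) *\<^sub>R pd 2 (pd 2 initial_torus) x"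
  have W: "?W = vec4 (- (rad' x / (rad x)\<^sup>2 * si 1 x) - k * co 1 x) (rad' x / (rad x)\<^sup>2 * co 1 x - k * si 1 x)
      (- (ifac x * co 2 x)) (- (ifac x * si 2 x))"
    using r by (simp add: initial_torus_metric initial_torus_pd_pd vec4_simps vec4_eq_iff k_def ifac_def)
      (simp add: divide_simps power2_eq_square, simp add: algebra_simps)
  have "normal_part initial_torus x ?W = ?H"
  proof (rule initial_torus.normal_part_unique)
    have "?H \<bullet> pd 2 initial_torus x = 2 * pi * curv x * co 2 x *
        ((co 1 x * co 1 x + si 1 x * si 1 x) - (co 2 x * co 2 x + si 2 x * si 2 x))"
      by (simp add: initial_torus_pd vec4_simps power2_eq_square algebra_simps del: sin_cos_squared_add3)
    then show "?H \<in> normal_space initial_torus x"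
      unfolding initial_torus.normal_space_iff by (simp add: co_si_sq) (simp add: initial_torus_pd vec4_simps algebra_simps)
    have "k * co 1 x - ifac x * k * co 1 x = k * (1 - ifac x) * co 1 x"
      "k * si 1 x - ifac x * k * si 1 x = k * (1 - ifac x) * si 1 x"
      by (simp_all add: algebra_simps)
    \<comment> \<open>The first coefficient is the component of \<open>?W\<close> along
      \<open>(- sin \<theta>, cos \<theta>)\<close> divided by the length
      \<open>2 * pi * rad x\<close> of the first field; the second is read off from the last two
      coordinates.\<close>
    then have "?W - ?H = (rad' x / (2 * pi * rad x ^ 3)) *\<^sub>R pd 1 initial_torus x
        + (- (k * ifac x * co 2 x / (2 * pi))) *\<^sub>R pd 2 initial_torus x"
      unfolding W unfolding initial_torus_pd vec4_simps vec4_eq_iff curv_def k_def[symmetric] q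
      using r by (simp add: power2_eq_square power3_eq_cube algebra_simps)
    then show "?W - ?H \<in> tangent_space initial_torus x" unfolding initial_torus.tangent_space_eq by blast
  qed
  then show ?thesis
    using initial_torus.mean_curvature_principal_coordinates[OF initial_torus_metric(3) initial_torus_pd_1_2] by simp
qed

text \<open>Reduces partial derivatives to one-variable calculus on coordinate lines.\<close>

lemma dirD_eq_line_derivative:
  fixes f :: "'a::real_normed_vector \<Rightarrow> real"
  assumes "f differentiable (at x)" "((\<lambda>s. f (x + s *\<^sub>R v)) has_real_derivative D) (at 0)"
  shows "dirD v f x = D"
proof (rule vector_derivative_unique_at)
  show "((\<lambda>s. f (x + s *\<^sub>R v)) has_vector_derivative dirD v f x) (at 0)"
    using dirD_line[of f x 0 v UNIV] assms(1) by simp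
  show "((\<lambda>s. f (x + s *\<^sub>R v)) has_vector_derivative D) (at 0)"
    using assms(2) by (simp add: has_real_derivative_iff_has_vector_derivative)
qed

text \<open>The vectors \<open>w\<close> and \<open>w'\<close> span the normal space at the origin.
  The flow supplies differentiability of \<open>H\<close> and of its first derivatives, so line
  derivatives of the explicit formula suffice.\<close>

lemma mean_curvature_initial_torus_derivatives:
  fixes F :: "real \<Rightarrow> real^2 \<Rightarrow> real^4"
  assumes flow: "mean_curvature_flow initial_torus T F"
  defines "H \<equiv> mean_curvature initial_torus"
  defines "w \<equiv> vec4 1 0 0 (- 1)" and "w' \<equiv> vec4 0 0 1 0"
  shows "pd 1 H 0 \<bullet> w = - 6 * pi / 25" "pd 1 H 0 \<bullet> w' = 0"
    and "pd 2 (pd 1 H) 0 \<bullet> w = 24 * pi\<^sup>2 / 125" "pd 2 (pd 1 H) 0 \<bullet> w' = - 6 * pi\<^sup>2 / 25"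
proof -
  note d = mean_curvature_flow_derivatives(1,2)[OF flow, folded H_def]
  have q: "1 + (co 2 y)\<^sup>2 \<noteq> 0" for y :: "real^2" using zero_le_power2[of "co 2 y"] by linarith
  have s: "5 + sin t \<noteq> 0" for t :: real using sin_ge_minus_one[of t] by linarith
  \<comment> \<open>Only a \<phi>-derivative at the origin follows, so points with \<theta> = 0
    suffice. There \<open>cos \<theta>\<close> is stationary, and the factor
    \<open>1 + ?C\<^sup>2\<close> cancels \<open>ifac y\<close>.\<close>
  have w: "pd 1 H y \<bullet> w = - 6 * pi / (5 + si 2 y)\<^sup>2" if "y $ 1 = 0" for y
  proof -
    let ?S = "si 2 y" and ?C = "co 2 y"
    have "(\<lambda>t. H (y + t *\<^sub>R axis 1 1) \<bullet> w) = (\<lambda>t. - (ifac y * (1 / (5 + ?S - 3 * sin (2 * pi * t) * cos (2 * pi * t))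
        + ifac y * ?S)) * (cos (2 * pi * t) + ?C\<^sup>2) + ifac y * ?S)"
      using that by (simp add: fun_eq_iff H_def mean_curvature_initial_torus w_def vec4_simps curv_def rad_def ifac_def axis_def
          algebra_simps add_divide_distrib)
    moreover have "(\<dots> has_real_derivative - (ifac y * (6 * pi / (5 + ?S)\<^sup>2)) * (1 + ?C\<^sup>2)) (at 0)"
      using s[of "2 * pi * y $ 2"] by (auto intro!: derivative_eq_intros simp: power2_eq_square)
    ultimately have "pd 1 (\<lambda>y. H y \<bullet> w) y = - (ifac y * (6 * pi / (5 + ?S)\<^sup>2)) * (1 + ?C\<^sup>2)"
      by (intro dirD_eq_line_derivative differentiable_inner d differentiable_const) simp
    then show ?thesis using q[of y] by (simp add: dirD_inner_const d ifac_def)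
  qed
  have w': "pd 1 H y \<bullet> w' = - 6 * pi * co 2 y * si 2 y / ((1 + (co 2 y)\<^sup>2) * (5 + si 2 y)\<^sup>2)" if "y $ 1 = 0" for y
  proof -
    let ?S = "si 2 y" and ?C = "co 2 y"
    have "(\<lambda>t. H (y + t *\<^sub>R axis 1 1) \<bullet> w') = (\<lambda>t. - (ifac y * (1 / (5 + ?S - 3 * sin (2 * pi * t) * cos (2 * pi * t))
        + ifac y * ?S)) * ?C * ?S - ifac y * ?C)"
      using that by (simp add: fun_eq_iff H_def mean_curvature_initial_torus w'_def vec4_simps curv_def rad_def ifac_def axis_def
          algebra_simps)
    moreover have "(\<dots> has_real_derivative - (ifac y * (6 * pi / (5 + ?S)\<^sup>2)) * ?C * ?S) (at 0)"
      using s[of "2 * pi * y $ 2"] by (auto intro!: derivative_eq_intros simp: power2_eq_square)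
    ultimately have "pd 1 (\<lambda>y. H y \<bullet> w') y = - (ifac y * (6 * pi / (5 + ?S)\<^sup>2)) * ?C * ?S"
      by (intro dirD_eq_line_derivative differentiable_inner d differentiable_const) simp
    then show ?thesis by (simp add: dirD_inner_const d ifac_def)
  qed
  show "pd 1 H 0 \<bullet> w = - 6 * pi / 25" "pd 1 H 0 \<bullet> w' = 0"
    using w[of 0] w'[of 0] by simp_all
  have ax: "axis 2 1 $ (1::2) = (0::real)" by (simp add: axis_def)
  have "pd 2 (\<lambda>y. pd 1 H y \<bullet> w) 0 = 24 * pi\<^sup>2 / 125"
  proof (rule dirD_eq_line_derivative)
    have "(\<lambda>s. pd 1 H (0 + s *\<^sub>R axis 2 1) \<bullet> w) = (\<lambda>s. - 6 * pi / (5 + sin (2 * pi * s))\<^sup>2)"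
      by (simp add: fun_eq_iff w ax)
    moreover have "(\<dots> has_real_derivative 24 * pi\<^sup>2 / 125) (at 0)"
      by (auto intro!: derivative_eq_intros simp: power2_eq_square)
    ultimately show "((\<lambda>s. pd 1 H (0 + s *\<^sub>R axis 2 1) \<bullet> w) has_real_derivative 24 * pi\<^sup>2 / 125) (at 0)"
      by simp
  qed (intro differentiable_inner d differentiable_const)
  then show "pd 2 (pd 1 H) 0 \<bullet> w = 24 * pi\<^sup>2 / 125" by (simp add: dirD_inner_const d)
  have "pd 2 (\<lambda>y. pd 1 H y \<bullet> w') 0 = - 6 * pi\<^sup>2 / 25"
  proof (rule dirD_eq_line_derivative)
    have "(\<lambda>s. pd 1 H (0 + s *\<^sub>R axis 2 1) \<bullet> w') = (\<lambda>s. - 6 * pi * cos (2 * pi * s) * sin (2 * pi * s)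
        / ((1 + (cos (2 * pi * s))\<^sup>2) * (5 + sin (2 * pi * s))\<^sup>2))"
      by (simp add: fun_eq_iff w' ax)
    moreover have "(\<dots> has_real_derivative - 6 * pi\<^sup>2 / 25) (at 0)"
      by (auto intro!: derivative_eq_intros simp: power2_eq_square)
    ultimately show "((\<lambda>s. pd 1 H (0 + s *\<^sub>R axis 2 1) \<bullet> w') has_real_derivative - 6 * pi\<^sup>2 / 25) (at 0)"
      by simp
  qed (intro differentiable_inner d differentiable_const)
  then show "pd 2 (pd 1 H) 0 \<bullet> w' = - 6 * pi\<^sup>2 / 25" by (simp add: dirD_inner_const d)
qed

theorem theorem1p1:
  shows "\<exists>F0 :: real^2 \<Rightarrow> real^4.
           torus_embedding F0 \<and> flat_normal_bundle F0 \<and>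
           (\<forall>T F. mean_curvature_flow F0 T F \<longrightarrow>
              (\<exists>\<delta>\<in>{0<..<T}. \<forall>t\<in>{0<..<\<delta>}. \<not> flat_normal_bundle (F t)))"
proof (intro exI[of _ initial_torus] conjI allI impI initial_torus_embedding initial_torus_flat)
  fix T F assume flow: "mean_curvature_flow initial_torus T F"
  let ?w = "vec4 1 0 0 (- 1)" and ?w' = "vec4 0 0 1 0" and ?a = "pd 1 initial_torus 0" and ?b = "pd 2 initial_torus 0"
    and ?H = "mean_curvature initial_torus"
  have a: "?a = vec4 0 (10 * pi) 0 0" and b: "?b = vec4 (2 * pi) 0 0 (2 * pi)"
    by (simp_all add: initial_torus_pd rad_def)
  define \<Delta> where "\<Delta> = gram ?a ?b"
  have \<Delta>: "\<Delta> > 0" unfolding \<Delta>_def by (rule initial_torus.gram_pos)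
  \<comment> \<open>Both vectors are already normal at the origin, so \<open>perp\<close> only
    rescales them.\<close>
  have perp: "perp ?a ?b ?w = \<Delta> *\<^sub>R ?w" "perp ?a ?b ?w' = \<Delta> *\<^sub>R ?w'"
    by (simp_all add: perp_def \<Delta>_def cof_def a b vec4_simps)
  have c: "pd 1 (pd 1 initial_torus) 0 = (4 * pi\<^sup>2) *\<^sub>R vec4 (- 5) (- 3) 0 0"
    and e: "pd 2 (pd 2 initial_torus) 0 = (4 * pi\<^sup>2) *\<^sub>R vec4 0 0 (- 1) 0"
    by (simp_all add: initial_torus_pd_pd rad_def rad'_def)
  have l: "pd 2 (pd 1 initial_torus) 0 = (2 * pi / 5) *\<^sub>R ?a"
    using initial_torus_pd_2_1[of 0] by (simp add: rad_def)
  note H' = mean_curvature_initial_torus_derivatives[OF flow]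
  have P: "perp ?a ?b ?w \<bullet> (pd 2 (pd 1 ?H) 0 - (2 * pi / 5) *\<^sub>R pd 1 ?H 0) = \<Delta> * (36 * pi\<^sup>2 / 125)"
    "perp ?a ?b ?w' \<bullet> (pd 2 (pd 1 ?H) 0 - (2 * pi / 5) *\<^sub>R pd 1 ?H 0) = \<Delta> * (- 6 * pi\<^sup>2 / 25)"
    unfolding perp using H'
    by (simp_all add: inner_diff_right inner_commute[of ?w] inner_commute[of ?w'] power2_eq_square)
  \<comment> \<open>In units of \<open>\<Delta>\<^sup>2 * pi ^ 6\<close>, the summand with
    \<open>?b \<bullet> ?b\<close> contributes -192/5 and the one with
    \<open>?a \<bullet> ?a\<close> contributes 576/5, so they do not cancel.\<close>
  have "(?b \<bullet> ?b) * ((\<Delta> * (36 * pi\<^sup>2 / 125)) * (perp ?a ?b ?w' \<bullet> pd 1 (pd 1 initial_torus) 0)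
        - (perp ?a ?b ?w \<bullet> pd 1 (pd 1 initial_torus) 0) * (\<Delta> * (- 6 * pi\<^sup>2 / 25)))
      + (?a \<bullet> ?a) * ((perp ?a ?b ?w \<bullet> pd 2 (pd 2 initial_torus) 0) * (\<Delta> * (- 6 * pi\<^sup>2 / 25))
        - (\<Delta> * (36 * pi\<^sup>2 / 125)) * (perp ?a ?b ?w' \<bullet> pd 2 (pd 2 initial_torus) 0))
      = \<Delta>\<^sup>2 * pi ^ 6 * (384 / 5)"
    unfolding perp c e by (simp add: a b vec4_simps power_numeral_reduce field_simps)
  moreover have "\<Delta>\<^sup>2 * pi ^ 6 * (384 / 5) \<noteq> 0" using \<Delta> by simp
  ultimately show "\<exists>\<delta>\<in>{0<..<T}. \<forall>t\<in>{0<..<\<delta>}. \<not> flat_normal_bundle (F t)"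
    by (intro not_flat_short_time[OF flow initial_torus_metric(3) l, of ?w ?w']) (simp only: P not_False_eq_True)
qed

end
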